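(* If $\Lambda$ is a row-finite source-free $k$-graph and $f\in\Lambda^1$ is an edge, then $\Lambda_D$, the graph of $\Lambda$ delayed at the edge $f$, is also a source-free $k$-graph.
   Context: Fix $k\ge1$; $0\in\mathbb{N}$; $e_1,\dots,e_k$ are the standard basis vectors of $\mathbb{N}^k$, and $\mathbb{N}^k$ is regarded as a category with one object, composition being addition. For $n=\sum n_ie_i$, $|n|=\sum n_i$. A $k$-graph is a countable category $\Lambda$ with a functor $d:\Lambda\to\mathbb{N}^k$ satisfying the factorization rule: for every morphism $\lambda$ and $n,m\in\mathbb{N}^k$ with $d(\lambda)=n+m$ there exist unique $\mu,\nu\in\Lambda$ with $d(\mu)=m$, $d(\nu)=n$, $\lambda=\mu\nu$. $\Lambda^n=d^{-1}(n)$; $\Lambda^0$ is the set of vertices (identified with objects); $\Lambda^1=\{\lambda:|d(\lambda)|=1\}$ is the set of edges. $r(\lambda),s(\lambda)\in\Lambda^0$ are the unique vertices with $r(\lambda)\lambda s(\lambda)=\lambda$. $\Lambda$ is row-finite if $|\{\lambda\in\Lambda^{e_i}:r(\lambda)=v\}|<\infty$ for all $v\in\Lambda^0$, $1\le i\le k$. A vertex $v$ is a source if $r^{-1}(v)\cap\Lambda^{e_i}=\emptyset$ for some $i$; $\Lambda$ is source-free if it has no sources. The 1-skeleton of $\Lambda$ is the directed graph $G=(\Lambda^0,\Lambda^1,r,s)$ with edges colored by $d$. For any $k$-colored directed graph, the path category (denoted by $*$, e.g. $G^*$) consists of all finite paths $f_n\cdots f_1$ with $s(f_i)=r(f_{i-1})$,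 including vertices as paths of length $0$, with range, source and (additively extended) degree. On $G^*$, $\lambda\sim\mu$ means that $\lambda$ and $\mu$ compose to the same morphism of $\Lambda$, and $[\lambda]\in\Lambda$ denotes that morphism; thus $\Lambda=G^*/\sim$. Delay at $f$: after relabelling the basis vectors, assume $d(f)=e_1$. Put $A_1=\{f\}\cup\{g\in\Lambda^{e_1}: ag\sim fb\text{ or }ga\sim bf\text{ for some }a,b\in\Lambda^{e_i},\ 2\le i\le k\}$, and for $m\ge2$ $A_m=\{e\in\Lambda^{e_1}: ag\sim eb\text{ or }ga\sim be\text{ for some }a,b\in\Lambda^{e_i},\ 2\le i\le k,\ g\in A_{m-1}\}$. Let $\mathcal{E}^{e_1}=\bigcup_{j\ge1}A_j$, and for $2\le i\le k$ let $\mathcal{E}^{e_i}=\{[ga]\in\Lambda: g\in\mathcal{E}^{e_1},\ a\in\Lambda^{e_i}\}$ (a set of commuting squares of degree $e_1+e_i$). Introduce new vertices $v_g$ ($g\in\mathcal{E}^{e_1}$) and new edges $\mathcal{E}_D^{e_1}=\{g^1,g^2:g\in\mathcal{E}^{e_1}\}$ of degree $e_1$, and $\mathcal{E}_D^{e_i}=\{e_\alpha:\alpha\in\mathcal{E}^{e_i}\}$ of degree $e_i$ for $2\le i\le k$. Define the $k$-colored graph $G_D=(\Lambda_D^0,\Lambda_D^1,r_D,s_D)$ by $\Lambda_D^0=\Lambda^0\cup\{v_g:g\in\mathcal{E}^{e_1}\}$, $\Lambda_D^{e_1}=(\Lambda^{e_1}\setminus\mathcal{E}^{e_1})\cup\mathcal{E}_D^{e_1}$,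 $\Lambda_D^{e_i}=\Lambda^{e_i}\cup\mathcal{E}_D^{e_i}$ for $i\ge2$; with $s_D(g^1)=s(g)$, $r_D(g^1)=v_g$, $s_D(g^2)=v_g$, $r_D(g^2)=r(g)$; and if $\alpha=[bg]=[ha]\in\mathcal{E}^{e_i}$ with $a,b\in\Lambda^{e_i}$ and $g,h\in\Lambda^{e_1}$, then $s_D(e_\alpha)=v_g$ and $r_D(e_\alpha)=v_h$. All other (old) edges keep their range, source and degree from $\Lambda$. The relation $\sim_D$ on two-colored paths of length 2 in $G_D$ is given as follows. Case 1: two such paths with all edges old (i.e. not in $\bigcup_{i=1}^k\mathcal{E}_D^{e_i}$) are equivalent iff they are equivalent under $\sim$ in $G$. Case 2: for each $2\le i\le k$ and each commuting square $[bg]=[ha]\in\mathcal{E}^{e_i}$ of $\Lambda$, where $g,h\in\mathcal{E}^{e_1}$ and $a,b\in\Lambda^{e_i}$ (so that $bg\sim ha$), $b\,g^2\sim_D h^2e_{[bg]}$ and $e_{[bg]}\,g^1\sim_D h^1a$. Case 3: let $e_\beta e_\alpha$ be a path with $\alpha\in\mathcal{E}^{e_i}$, $\beta\in\mathcal{E}^{e_j}$, $i\neq j$, $i,j\ge2$, so that $\alpha=[ga]=[bh]$ and $\beta=[cg]=[ld]$ with $g,h,l\in\mathcal{E}^{e_1}$, $a,b\in\Lambda^{e_i}$, $c,d\in\Lambda^{e_j}$. The morphism $[cga]$ of degree $e_1+e_i+e_j$ determines a 3-cube of commuting squares in $\Lambda$; let $\delta$ and $\gamma$ be the faces opposite $\beta$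 and $\alpha$ respectively. Explicitly, write $cb\sim b'c'$ with $b'\in\Lambda^{e_i}$, $c'\in\Lambda^{e_j}$, and $c'h\sim l'd'$ with $l'\in\Lambda^{e_1}$, $d'\in\Lambda^{e_j}$; then $\delta=[c'h]\in\mathcal{E}^{e_j}$ and $\gamma=[b'l']\in\mathcal{E}^{e_i}$. Set $e_\beta e_\alpha\sim_D e_\gamma e_\delta$. Extend $\sim_D$ to the smallest equivalence relation on $G_D^*$ that contains these relations and is compatible with concatenation (if $\lambda=\lambda_2\lambda_1$, $p_1\sim_D\lambda_1$ and $p_2\sim_D\lambda_2$, then $p_2p_1\sim_D\lambda$); on single edges it is equality. Define $\Lambda_D=G_D^*/\sim_D$, with composition induced by concatenation and degree map $d_D$ induced by the coloring. This is the graph of $\Lambda$ delayed at $f$. *)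

theory Defs
  imports "HOL-Analysis.Finite_Cartesian_Product" "HOL-Library.Countable_Set"
begin

text \<open>
  The monoid of degrees is \<open>nat ^ 'k\<close>, with \<open>'k\<close> a finite (nonempty) index type; its
  standard basis vectors are \<open>axis i 1\<close>.
\<close>

definition vsize :: "nat ^ 'k::finite \<Rightarrow> nat" where
  "vsize n = (\<Sum>i\<in>UNIV. n $ i)"


section \<open>Higher-rank graphs\<close>

text \<open>
  Categories are presented by their morphisms alone, objects being identified with identity
  morphisms. So \<open>rng x\<close> and \<open>src x\<close> are morphisms, and \<open>cmp x y\<close> (written $xy$, first \<open>y\<close> then
  \<open>x\<close>) is meaningful only if \<open>src x = rng y\<close>.
\<close>

record ('a, 'k) kgraph =
  Mor :: "'a set"
  rng :: "'a \<Rightarrow> 'a"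
  src :: "'a \<Rightarrow> 'a"
  cmp :: "'a \<Rightarrow> 'a \<Rightarrow> 'a"
  deg :: "'a \<Rightarrow> nat ^ 'k"

definition category :: "('a, 'k::finite) kgraph \<Rightarrow> bool" where
  "category L \<longleftrightarrow>
     (\<forall>x\<in>Mor L. rng L x \<in> Mor L \<and> src L x \<in> Mor L \<and>
        rng L (rng L x) = rng L x \<and> src L (rng L x) = rng L x \<and>
        rng L (src L x) = src L x \<and> src L (src L x) = src L x \<and>
        cmp L (rng L x) x = x \<and> cmp L x (src L x) = x) \<and>
     (\<forall>x\<in>Mor L. \<forall>y\<in>Mor L. src L x = rng L y \<longrightarrow>
        cmp L x y \<in> Mor L \<and> rng L (cmp L x y) = rng L x \<and> src L (cmp L x y) = src L y) \<and>
     (\<forall>x\<in>Mor L. \<forall>y\<in>Mor L. \<forall>z\<in>Mor L. src L x = rng L y \<longrightarrow> src L y = rng L z \<longrightarrow>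
        cmp L (cmp L x y) z = cmp L x (cmp L y z))"

definition degree_functor :: "('a, 'k::finite) kgraph \<Rightarrow> bool" where
  "degree_functor L \<longleftrightarrow>
     (\<forall>x\<in>Mor L. deg L (rng L x) = 0 \<and> deg L (src L x) = 0) \<and>
     (\<forall>x\<in>Mor L. \<forall>y\<in>Mor L. src L x = rng L y \<longrightarrow> deg L (cmp L x y) = deg L x + deg L y)"

definition factorization_rule :: "('a, 'k::finite) kgraph \<Rightarrow> bool" where
  "factorization_rule L \<longleftrightarrow>
     (\<forall>x\<in>Mor L. \<forall>n m. deg L x = n + m \<longrightarrow>
        (\<exists>!(y, z). y \<in> Mor L \<and> z \<in> Mor L \<and> src L y = rng L z \<and>
                   deg L y = m \<and> deg L z = n \<and> x = cmp L y z))"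

definition k_graph :: "('a, 'k::finite) kgraph \<Rightarrow> bool" where
  "k_graph L \<longleftrightarrow>
     category L \<and> countable (Mor L) \<and> degree_functor L \<and> factorization_rule L"

definition layer :: "('a, 'k::finite) kgraph \<Rightarrow> nat ^ 'k \<Rightarrow> 'a set" where
  "layer L n = {x \<in> Mor L. deg L x = n}"

definition edges :: "('a, 'k::finite) kgraph \<Rightarrow> 'a set" where
  "edges L = {x \<in> Mor L. vsize (deg L x) = 1}"

definition row_finite :: "('a, 'k::finite) kgraph \<Rightarrow> bool" where
  "row_finite L \<longleftrightarrow> (\<forall>v\<in>layer L 0. \<forall>i. finite {x \<in> layer L (axis i 1). rng L x = v})"

definition is_source :: "('a, 'k::finite) kgraph \<Rightarrow> 'a \<Rightarrow> bool" where
  "is_source L v \<longleftrightarrow> v \<in> layer L 0 \<and> (\<exists>i. {x \<in> layer L (axis i 1). rng L x = v} = {})"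

definition source_free :: "('a, 'k::finite) kgraph \<Rightarrow> bool" where
  "source_free L \<longleftrightarrow> (\<nexists>v. is_source L v)"


section \<open>Coloured graphs and their path categories\<close>

record ('v, 'e, 'k) cgraph =
  gverts :: "'v set"
  gedges :: "'e set"
  grng :: "'e \<Rightarrow> 'v"
  gsrc :: "'e \<Rightarrow> 'v"
  gdeg :: "'e \<Rightarrow> nat ^ 'k"  \<comment> \<open>the colour of an edge, as a basis vector\<close>

text \<open>
  The path $f_n \cdots f_1$ is the pair of its range and the list \<open>[f\<^sub>n, \<dots>, f\<^sub>1]\<close>; a vertex \<open>v\<close>
  is the path \<open>(v, [])\<close>.
\<close>

type_synonym ('v, 'e) path = "'v \<times> 'e list"

fun walk :: "('v, 'e, 'k::finite) cgraph \<Rightarrow> 'v \<Rightarrow> 'e list \<Rightarrow> bool" where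
  "walk G v [] \<longleftrightarrow> v \<in> gverts G"
| "walk G v (x # xs) \<longleftrightarrow> v \<in> gverts G \<and> x \<in> gedges G \<and> grng G x = v \<and> walk G (gsrc G x) xs"

definition paths :: "('v, 'e, 'k::finite) cgraph \<Rightarrow> ('v, 'e) path set" where
  "paths G = {(v, xs). walk G v xs}"

definition psrc :: "('v, 'e, 'k::finite) cgraph \<Rightarrow> ('v, 'e) path \<Rightarrow> 'v" where
  "psrc G p = (if snd p = [] then fst p else gsrc G (last (snd p)))"

definition pcat :: "('v, 'e) path \<Rightarrow> ('v, 'e) path \<Rightarrow> ('v, 'e) path" where
  "pcat p q = (fst p, snd p @ snd q)"

definition pdeg :: "('v, 'e, 'k::finite) cgraph \<Rightarrow> ('v, 'e) path \<Rightarrow> nat ^ 'k" where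
  "pdeg G p = sum_list (map (gdeg G) (snd p))"

definition path2 :: "('v, 'e, 'k::finite) cgraph \<Rightarrow> 'e \<Rightarrow> 'e \<Rightarrow> ('v, 'e) path" where
  "path2 G x y = (grng G x, [x, y])"

inductive path_cong ::
  "('v, 'e, 'k::finite) cgraph \<Rightarrow> (('v, 'e) path \<Rightarrow> ('v, 'e) path \<Rightarrow> bool) \<Rightarrow>
   ('v, 'e) path \<Rightarrow> ('v, 'e) path \<Rightarrow> bool"
  for G R where
  base: "p \<in> paths G \<Longrightarrow> q \<in> paths G \<Longrightarrow> R p q \<Longrightarrow> path_cong G R p q"
| refl: "p \<in> paths G \<Longrightarrow> path_cong G R p p"
| sym: "path_cong G R p q \<Longrightarrow> path_cong G R q p"
| trans: "path_cong G R p q \<Longrightarrow> path_cong G R q u \<Longrightarrow> path_cong G R p u"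
| concat: "path_cong G R p2 q2 \<Longrightarrow> path_cong G R p1 q1 \<Longrightarrow>
     psrc G p2 = fst p1 \<Longrightarrow> psrc G q2 = fst q1 \<Longrightarrow>
     path_cong G R (pcat p2 p1) (pcat q2 q1)"

definition cong_rel ::
  "('v, 'e, 'k::finite) cgraph \<Rightarrow> (('v, 'e) path \<Rightarrow> ('v, 'e) path \<Rightarrow> bool) \<Rightarrow>
   (('v, 'e) path \<times> ('v, 'e) path) set" where
  "cong_rel G R = {(p, q). path_cong G R p q}"

text \<open>
  The structure maps on equivalence classes are unions over all choices of representatives,
  as in \<^theory>\<open>HOL.Equiv_Relations\<close>.
\<close>

definition path_quotient ::
  "('v, 'e, 'k::finite) cgraph \<Rightarrow> (('v, 'e) path \<Rightarrow> ('v, 'e) path \<Rightarrow> bool) \<Rightarrow>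
   (('v, 'e) path set, 'k) kgraph" where
  "path_quotient G R =
     \<lparr> Mor = paths G // cong_rel G R,
       rng = (\<lambda>X. \<Union>p\<in>X. cong_rel G R `` {(fst p, [])}),
       src = (\<lambda>X. \<Union>p\<in>X. cong_rel G R `` {(psrc G p, [])}),
       cmp = (\<lambda>X Y. \<Union>p\<in>X. \<Union>q\<in>Y. cong_rel G R `` {pcat p q}),
       deg = (\<lambda>X. the_elem (pdeg G ` X)) \<rparr>"


section \<open>The 1-skeleton\<close>

definition skeleton :: "('a, 'k::finite) kgraph \<Rightarrow> ('a, 'a, 'k) cgraph" where
  "skeleton L =
     \<lparr> gverts = layer L 0, gedges = edges L, grng = rng L, gsrc = src L, gdeg = deg L \<rparr>"

fun compose_walk :: "('a, 'k::finite) kgraph \<Rightarrow> 'a \<Rightarrow> 'a list \<Rightarrow> 'a" where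
  "compose_walk L v [] = v"
| "compose_walk L v (x # xs) = cmp L x (compose_walk L (src L x) xs)"

definition bracket :: "('a, 'k::finite) kgraph \<Rightarrow> ('a, 'a) path \<Rightarrow> 'a" where
  "bracket L p = compose_walk L (fst p) (snd p)"

definition sim :: "('a, 'k::finite) kgraph \<Rightarrow> ('a, 'a) path \<Rightarrow> ('a, 'a) path \<Rightarrow> bool" where
  "sim L p q \<longleftrightarrow>
     p \<in> paths (skeleton L) \<and> q \<in> paths (skeleton L) \<and> bracket L p = bracket L q"

abbreviation sk2 :: "('a, 'k::finite) kgraph \<Rightarrow> 'a \<Rightarrow> 'a \<Rightarrow> ('a, 'a) path" where
  "sk2 L \<equiv> path2 (skeleton L)"


section \<open>Delaying a \<open>k\<close>-graph at an edge\<close>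

text \<open>
  Instead of relabelling the basis so that the delayed edge \<open>f\<close> has degree $e_1$, we write
  \<open>deg L f\<close> for $e_1$; the indices $2 \le i \le k$ are those in \<open>other L f\<close>.
\<close>

definition other :: "('a, 'k::finite) kgraph \<Rightarrow> 'a \<Rightarrow> 'k set" where
  "other L f = {i. axis i 1 \<noteq> deg L f}"

definition opposite :: "('a, 'k::finite) kgraph \<Rightarrow> 'a \<Rightarrow> 'a \<Rightarrow> 'a \<Rightarrow> bool" where
  "opposite L f g e \<longleftrightarrow>
     (\<exists>i\<in>other L f. \<exists>a\<in>layer L (axis i 1). \<exists>b\<in>layer L (axis i 1).
        sim L (sk2 L a g) (sk2 L e b) \<or> sim L (sk2 L g a) (sk2 L b e))"

text \<open>\<open>delay_stage L f m\<close> is $A_{m+1}$.\<close>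

primrec delay_stage :: "('a, 'k::finite) kgraph \<Rightarrow> 'a \<Rightarrow> nat \<Rightarrow> 'a set" where
  "delay_stage L f 0 = {f} \<union> {g \<in> layer L (deg L f). opposite L f g f}"
| "delay_stage L f (Suc m) =
     {e \<in> layer L (deg L f). \<exists>g\<in>delay_stage L f m. opposite L f g e}"

definition delayed_edges :: "('a, 'k::finite) kgraph \<Rightarrow> 'a \<Rightarrow> 'a set" where
  "delayed_edges L f = (\<Union>m. delay_stage L f m)"

definition delayed_squares :: "('a, 'k::finite) kgraph \<Rightarrow> 'a \<Rightarrow> 'k \<Rightarrow> 'a set" where
  "delayed_squares L f i =
     {bracket L (sk2 L g a) | g a.
        g \<in> delayed_edges L f \<and> a \<in> layer L (axis i 1) \<and> sk2 L g a \<in> paths (skeleton L)}"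

text \<open>
  \<open>Mid g\<close> is the new vertex $v_g$, \<open>Fst g\<close> and \<open>Snd g\<close> are $g^1$ and $g^2$, and \<open>Sq i \<alpha>\<close> is
  $e_\alpha$ for a square \<open>\<alpha>\<close> in \<open>delayed_squares L f i\<close>.
\<close>

datatype 'a dvert = OldV 'a | Mid 'a
datatype ('a, 'k) dedge = OldE 'a | Fst 'a | Snd 'a | Sq 'k 'a

text \<open>If $\alpha = [bg] = [ha]$ with \<open>a\<close>, \<open>b\<close> of degree $e_i$ and \<open>g\<close>, \<open>h\<close> of degree $e_1$, then
  \<open>sq_right\<close> is \<open>g\<close> and \<open>sq_left\<close> is \<open>h\<close>.\<close>

definition sq_right :: "('a, 'k::finite) kgraph \<Rightarrow> 'a \<Rightarrow> 'k \<Rightarrow> 'a \<Rightarrow> 'a" where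
  "sq_right L f i \<alpha> =
     (THE g. g \<in> layer L (deg L f) \<and>
        (\<exists>b\<in>layer L (axis i 1). sk2 L b g \<in> paths (skeleton L) \<and> bracket L (sk2 L b g) = \<alpha>))"

definition sq_left :: "('a, 'k::finite) kgraph \<Rightarrow> 'a \<Rightarrow> 'k \<Rightarrow> 'a \<Rightarrow> 'a" where
  "sq_left L f i \<alpha> =
     (THE h. h \<in> layer L (deg L f) \<and>
        (\<exists>a\<in>layer L (axis i 1). sk2 L h a \<in> paths (skeleton L) \<and> bracket L (sk2 L h a) = \<alpha>))"

primrec delay_src :: "('a, 'k::finite) kgraph \<Rightarrow> 'a \<Rightarrow> ('a, 'k) dedge \<Rightarrow> 'a dvert" where
  "delay_src L f (OldE x) = OldV (src L x)"
| "delay_src L f (Fst g) = OldV (src L g)"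
| "delay_src L f (Snd g) = Mid g"
| "delay_src L f (Sq i \<alpha>) = Mid (sq_right L f i \<alpha>)"

primrec delay_rng :: "('a, 'k::finite) kgraph \<Rightarrow> 'a \<Rightarrow> ('a, 'k) dedge \<Rightarrow> 'a dvert" where
  "delay_rng L f (OldE x) = OldV (rng L x)"
| "delay_rng L f (Fst g) = Mid g"
| "delay_rng L f (Snd g) = OldV (rng L g)"
| "delay_rng L f (Sq i \<alpha>) = Mid (sq_left L f i \<alpha>)"

primrec delay_deg :: "('a, 'k::finite) kgraph \<Rightarrow> 'a \<Rightarrow> ('a, 'k) dedge \<Rightarrow> nat ^ 'k" where
  "delay_deg L f (OldE x) = deg L x"
| "delay_deg L f (Fst g) = deg L f"
| "delay_deg L f (Snd g) = deg L f"
| "delay_deg L f (Sq i \<alpha>) = axis i 1"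

definition delay_graph ::
  "('a, 'k::finite) kgraph \<Rightarrow> 'a \<Rightarrow> ('a dvert, ('a, 'k) dedge, 'k) cgraph" where
  "delay_graph L f =
     \<lparr> gverts = OldV ` layer L 0 \<union> Mid ` delayed_edges L f,
       gedges = OldE ` (edges L - delayed_edges L f) \<union>
                Fst ` delayed_edges L f \<union> Snd ` delayed_edges L f \<union>
                {Sq i \<alpha> | i \<alpha>. i \<in> other L f \<and> \<alpha> \<in> delayed_squares L f i},
       grng = delay_rng L f,
       gsrc = delay_src L f,
       gdeg = delay_deg L f \<rparr>"

abbreviation dl2 ::
  "('a, 'k::finite) kgraph \<Rightarrow> 'a \<Rightarrow> ('a, 'k) dedge \<Rightarrow> ('a, 'k) dedge \<Rightarrow>
   ('a dvert, ('a, 'k) dedge) path" where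
  "dl2 L f \<equiv> path2 (delay_graph L f)"

text \<open>
  In rule \<open>cube\<close>, \<open>\<alpha>\<close> and \<open>\<beta>\<close> are adjacent faces, sharing the edge \<open>g\<close>, of the 3-cube of $[cga]$;
  \<open>\<delta>\<close> and \<open>\<gamma>\<close> are the faces opposite \<open>\<beta>\<close> and \<open>\<alpha>\<close>. The colours of the two old edges in rule
  \<open>old\<close> may both differ from that of \<open>f\<close>.
\<close>

inductive delay_gen ::
  "('a, 'k::finite) kgraph \<Rightarrow> 'a \<Rightarrow> ('a dvert, ('a, 'k) dedge) path \<Rightarrow>
   ('a dvert, ('a, 'k) dedge) path \<Rightarrow> bool"
  for L f where
  old: "{x, y, x', y'} \<inter> delayed_edges L f = {} \<Longrightarrow> deg L x \<noteq> deg L y \<Longrightarrow> deg L x' \<noteq> deg L y' \<Longrightarrow>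
     sim L (sk2 L x y) (sk2 L x' y') \<Longrightarrow>
     delay_gen L f (dl2 L f (OldE x) (OldE y)) (dl2 L f (OldE x') (OldE y'))"
| square_upper: "i \<in> other L f \<Longrightarrow> g \<in> delayed_edges L f \<Longrightarrow> h \<in> delayed_edges L f \<Longrightarrow>
     a \<in> layer L (axis i 1) \<Longrightarrow> b \<in> layer L (axis i 1) \<Longrightarrow>
     sim L (sk2 L b g) (sk2 L h a) \<Longrightarrow> \<alpha> = bracket L (sk2 L b g) \<Longrightarrow>
     delay_gen L f (dl2 L f (OldE b) (Snd g)) (dl2 L f (Snd h) (Sq i \<alpha>))"
| square_lower: "i \<in> other L f \<Longrightarrow> g \<in> delayed_edges L f \<Longrightarrow> h \<in> delayed_edges L f \<Longrightarrow>
     a \<in> layer L (axis i 1) \<Longrightarrow> b \<in> layer L (axis i 1) \<Longrightarrow>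
     sim L (sk2 L b g) (sk2 L h a) \<Longrightarrow> \<alpha> = bracket L (sk2 L b g) \<Longrightarrow>
     delay_gen L f (dl2 L f (Sq i \<alpha>) (Fst g)) (dl2 L f (Fst h) (OldE a))"
| cube: "i \<in> other L f \<Longrightarrow> j \<in> other L f \<Longrightarrow> i \<noteq> j \<Longrightarrow>
     g \<in> delayed_edges L f \<Longrightarrow> h \<in> delayed_edges L f \<Longrightarrow> l \<in> delayed_edges L f \<Longrightarrow>
     l' \<in> layer L (deg L f) \<Longrightarrow>
     a \<in> layer L (axis i 1) \<Longrightarrow> b \<in> layer L (axis i 1) \<Longrightarrow> b' \<in> layer L (axis i 1) \<Longrightarrow>
     c \<in> layer L (axis j 1) \<Longrightarrow> d \<in> layer L (axis j 1) \<Longrightarrow>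
     c' \<in> layer L (axis j 1) \<Longrightarrow> d' \<in> layer L (axis j 1) \<Longrightarrow>
     sim L (sk2 L g a) (sk2 L b h) \<Longrightarrow> \<alpha> = bracket L (sk2 L g a) \<Longrightarrow>
     sim L (sk2 L c g) (sk2 L l d) \<Longrightarrow> \<beta> = bracket L (sk2 L c g) \<Longrightarrow>
     sim L (sk2 L c b) (sk2 L b' c') \<Longrightarrow>
     sim L (sk2 L c' h) (sk2 L l' d') \<Longrightarrow>
     \<delta> = bracket L (sk2 L c' h) \<Longrightarrow> \<gamma> = bracket L (sk2 L b' l') \<Longrightarrow>
     delay_gen L f (dl2 L f (Sq j \<beta>) (Sq i \<alpha>)) (dl2 L f (Sq i \<gamma>) (Sq j \<delta>))"

definition delayed ::
  "('a, 'k::finite) kgraph \<Rightarrow> 'a \<Rightarrow> (('a dvert, ('a, 'k) dedge) path set, 'k) kgraph" where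
  "delayed L f = path_quotient (delay_graph L f) (delay_gen L f)"

end

theory Submission
  imports Defs
begin

text \<open>
  Let $\Lambda$ be the given \<open>k\<close>-graph, \<open>c\<close> the colour of \<open>f\<close>, and \<open>D\<close> the set of delayed edges:
  the class of \<open>f\<close> under being opposite sides of a commuting square. The delayed graph has an
  explicit model. Regard each vertex \<open>v\<close> of $\Lambda$ as its identity morphism and the midpoint of
  \<open>g \<in> D\<close> as the morphism \<open>g\<close>. Then the delayed graph is the category of arrows of $\Lambda$, restricted
  to these objects: its morphisms from \<open>w\<close> to \<open>v\<close> are the commuting squares \<open>m w = v n\<close> in $\Lambda$,
  and the degree of such a square is the degree of \<open>m\<close> plus, in direction \<open>c\<close>, the number of edges
  in \<open>n\<close> that belong to \<open>D\<close>.

  The number of delayed edges on a path depends only on its composite, since a commuting square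
  has as many of them on either side (\<open>additive_extension\<close>). That the model is a category graded by
  degree is then immediate. For the factorization rule it suffices to split off one edge at a time
  (\<open>factorization_rule_if_edges\<close>), which reduces to unique factorization in $\Lambda$
  (\<open>arrow_first_edge\<close>, \<open>arrow_first_edge_unique\<close>). Sources cannot arise, since an edge of $\Lambda$ whose
  range is the source of \<open>g \<in> D\<close> can be carried along \<open>g\<close> (\<open>arrow_source_free\<close>).

  The edges of the model are those of the delayed coloured graph (\<open>edge_arrow\<close>), and the
  generating relations hold in the model (\<open>delay_gen_sound\<close>) and include all its commuting squares
  (\<open>square_c\<close>, \<open>square_other\<close>). A \<open>k\<close>-graph is always presented by its edges and its commuting
  squares: two paths with the same composite can be transformed into each other by exchanging the
  sides of squares (\<open>path_cong_if_eval_eq\<close>). So the quotient of the path category is isomorphic to the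
  model (\<open>quotient_iso\<close>), and inherits its properties.
\<close>

section \<open>Degrees\<close>

(* Simplification would otherwise turn axis i 1 into axis i (Suc 0). *)
declare One_nat_def [simp del]

lemma vsize_add: "vsize (m + n) = vsize m + vsize n"
  by (simp add: vsize_def sum.distrib)

lemma vsize_eq_0_iff: "vsize n = 0 \<longleftrightarrow> n = 0"
  by (simp add: vsize_def vec_eq_iff)

lemma vsize_axis: "vsize (axis i 1) = 1"
  by (simp add: vsize_def axis_def)

lemma axis_one_inject: "axis i 1 = (axis j 1 :: nat ^ 'k::finite) \<longleftrightarrow> i = j"
  by (simp add: axis_eq_axis)

lemma axis_one_nonzero: "axis i (1 :: nat) \<noteq> 0"
  by (simp add: axis_eq_0_iff)

lemma axis_one_plus: "0 < (n :: nat ^ 'k::finite) $ i \<Longrightarrow> \<exists>m. n = axis i 1 + m"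
  by (rule exI[of _ "n - axis i 1"]) (auto simp: vec_eq_iff axis_def)

lemma nonzero_degree_component: "(n :: nat ^ 'k::finite) \<noteq> 0 \<Longrightarrow> \<exists>i. 0 < n $ i"
  by (auto simp: vec_eq_iff)

lemma vsize_eq_1_iff: "vsize n = 1 \<longleftrightarrow> (\<exists>i. n = axis i 1)"
proof
  assume n: "vsize n = 1"
  then have "n \<noteq> 0" by (auto simp: vsize_def)
  then obtain i m where "n = axis i 1 + m"
    using nonzero_degree_component axis_one_plus by metis
  with n show "\<exists>i. n = axis i 1"
    by (auto simp: vsize_add vsize_axis vsize_eq_0_iff)
qed (auto simp: vsize_axis)

lemma layer_subset: "x \<in> layer L n \<Longrightarrow> x \<in> Mor L"
  by (simp add: layer_def)

lemma layer_deg: "x \<in> layer L n \<Longrightarrow> deg L x = n"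
  by (simp add: layer_def)

lemma edges_iff_layer: "x \<in> edges L \<longleftrightarrow> (\<exists>i. x \<in> layer L (axis i 1))"
  by (auto simp: edges_def layer_def vsize_eq_1_iff)

section \<open>Categories graded by degree\<close>

locale graded_category =
  fixes L :: "('a, 'k::finite) kgraph"
  assumes category: "category L" and degree_functor: "degree_functor L"
begin

abbreviation comp (infixr "\<cdot>" 70) where "x \<cdot> y \<equiv> cmp L x y"

lemma rng_in [simp]: "x \<in> Mor L \<Longrightarrow> rng L x \<in> Mor L"
  and src_in [simp]: "x \<in> Mor L \<Longrightarrow> src L x \<in> Mor L"
  and rng_rng [simp]: "x \<in> Mor L \<Longrightarrow> rng L (rng L x) = rng L x"
  and src_rng [simp]: "x \<in> Mor L \<Longrightarrow> src L (rng L x) = rng L x"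
  and rng_src [simp]: "x \<in> Mor L \<Longrightarrow> rng L (src L x) = src L x"
  and src_src [simp]: "x \<in> Mor L \<Longrightarrow> src L (src L x) = src L x"
  and comp_rng [simp]: "x \<in> Mor L \<Longrightarrow> rng L x \<cdot> x = x"
  and comp_src [simp]: "x \<in> Mor L \<Longrightarrow> x \<cdot> src L x = x"
  using category unfolding category_def by blast+

lemma comp_in [simp]: "x \<in> Mor L \<Longrightarrow> y \<in> Mor L \<Longrightarrow> src L x = rng L y \<Longrightarrow> x \<cdot> y \<in> Mor L"
  and rng_comp [simp]:
    "x \<in> Mor L \<Longrightarrow> y \<in> Mor L \<Longrightarrow> src L x = rng L y \<Longrightarrow> rng L (x \<cdot> y) = rng L x"
  and src_comp [simp]:
    "x \<in> Mor L \<Longrightarrow> y \<in> Mor L \<Longrightarrow> src L x = rng L y \<Longrightarrow> src L (x \<cdot> y) = src L y"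
  using category unfolding category_def by blast+

lemma comp_assoc:
  "x \<in> Mor L \<Longrightarrow> y \<in> Mor L \<Longrightarrow> z \<in> Mor L \<Longrightarrow> src L x = rng L y \<Longrightarrow> src L y = rng L z \<Longrightarrow>
     (x \<cdot> y) \<cdot> z = x \<cdot> (y \<cdot> z)"
  using category unfolding category_def by blast

lemma comp_rng_eq: "x \<in> Mor L \<Longrightarrow> rng L x = u \<Longrightarrow> u \<cdot> x = x"
  and comp_src_eq: "x \<in> Mor L \<Longrightarrow> src L x = u \<Longrightarrow> x \<cdot> u = x"
  by auto

lemma square_ends:
  assumes "x \<in> Mor L" "y \<in> Mor L" "x' \<in> Mor L" "y' \<in> Mor L" "src L x = rng L y" "src L x' = rng L y'"
    "x \<cdot> y = x' \<cdot> y'"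
  shows "rng L x = rng L x'" "src L y = src L y'"
  using assms rng_comp src_comp by metis+

lemma deg_rng [simp]: "x \<in> Mor L \<Longrightarrow> deg L (rng L x) = 0"
  and deg_src [simp]: "x \<in> Mor L \<Longrightarrow> deg L (src L x) = 0"
  and deg_comp [simp]:
    "x \<in> Mor L \<Longrightarrow> y \<in> Mor L \<Longrightarrow> src L x = rng L y \<Longrightarrow> deg L (x \<cdot> y) = deg L x + deg L y"
  using degree_functor unfolding degree_functor_def by blast+

text \<open>The factorization rule follows from its special case in which the left factor is a single
  edge, by peeling off one edge at a time. Hypothesis \<open>id\<close> settles the case of no edge.\<close>

lemma factorization_rule_if_edges:
  assumes id: "\<And>x. x \<in> Mor L \<Longrightarrow> deg L x = 0 \<Longrightarrow> rng L x = x"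
    and ex: "\<And>x i. x \<in> Mor L \<Longrightarrow> 0 < deg L x $ i \<Longrightarrow>
      \<exists>y z. y \<in> layer L (axis i 1) \<and> z \<in> Mor L \<and> src L y = rng L z \<and> x = y \<cdot> z"
    and uniq: "\<And>y z y' z' i. y \<in> layer L (axis i 1) \<Longrightarrow> y' \<in> layer L (axis i 1) \<Longrightarrow>
      z \<in> Mor L \<Longrightarrow> z' \<in> Mor L \<Longrightarrow> src L y = rng L z \<Longrightarrow> src L y' = rng L z' \<Longrightarrow>
      y \<cdot> z = y' \<cdot> z' \<Longrightarrow> y = y' \<and> z = z'"
  shows "factorization_rule L"
proof -
  have split: "\<exists>y z. y \<in> Mor L \<and> z \<in> Mor L \<and> src L y = rng L z \<and> deg L y = m \<and> deg L z = n \<and>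
      x = y \<cdot> z" if "x \<in> Mor L" "deg L x = m + n" for x m n
    using that
  proof (induction "vsize m" arbitrary: x m)
    case 0
    then have "m = 0" by (metis vsize_eq_0_iff)
    with 0 show ?case by (intro exI[of _ "rng L x"] exI[of _ x]) auto
  next
    case (Suc l)
    then have "m \<noteq> 0" by (auto simp: vsize_def)
    then obtain i m' where m: "m = axis i 1 + m'"
      using nonzero_degree_component axis_one_plus by metis
    have l: "l = vsize m'" using Suc.hyps(2) by (simp add: m vsize_add vsize_axis)
    have "0 < deg L x $ i" using Suc.prems by (simp add: m axis_def)
    from ex[OF Suc.prems(1) this] obtain y z where
      y: "y \<in> layer L (axis i 1)" and z: "z \<in> Mor L" "src L y = rng L z" "x = y \<cdot> z" by blast
    note y' = layer_subset[OF y] layer_deg[OF y]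
    have "deg L z = m' + n" using Suc.prems y' z by (simp add: m add.assoc)
    from Suc.hyps(1)[OF l z(1) this] obtain z1 z2 where
      "z1 \<in> Mor L" "z2 \<in> Mor L" "src L z1 = rng L z2" "deg L z1 = m'" "deg L z2 = n" "z = z1 \<cdot> z2"
      by blast
    with y' z show ?case
      by (intro exI[of _ "y \<cdot> z1"] exI[of _ z2]) (simp add: m comp_assoc)
  qed
  have same: "y = y' \<and> z = z'"
    if "y \<in> Mor L" "z \<in> Mor L" "y' \<in> Mor L" "z' \<in> Mor L" "src L y = rng L z" "src L y' = rng L z'"
      "deg L y = deg L y'" "y \<cdot> z = y' \<cdot> z'" for y z y' z'
    using that
  proof (induction "vsize (deg L y)" arbitrary: y y' z z')
    case 0
    then have "deg L y = 0" by (metis vsize_eq_0_iff)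
    then have "y = rng L y" "y' = rng L y'" using id 0 by force+
    then show ?case using 0 by (metis src_rng comp_rng rng_comp)
  next
    case (Suc l)
    then have "deg L y \<noteq> 0" by (auto simp: vsize_def)
    then obtain i where i: "0 < deg L y $ i"
      using nonzero_degree_component by metis
    from ex[OF Suc.prems(1) i] obtain u t where
      u: "u \<in> layer L (axis i 1)" and t: "t \<in> Mor L" "src L u = rng L t" "y = u \<cdot> t" by blast
    have i': "0 < deg L y' $ i" using i Suc.prems by simp
    from ex[OF Suc.prems(3) i'] obtain u' t' where
      u': "u' \<in> layer L (axis i 1)" and t': "t' \<in> Mor L" "src L u' = rng L t'" "y' = u' \<cdot> t'"
      by blast
    note uu = layer_subset[OF u] layer_deg[OF u] layer_subset[OF u'] layer_deg[OF u']
    have "u = u' \<and> t \<cdot> z = t' \<cdot> z'"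
      using Suc.prems t t' uu by (intro uniq[OF u u']) (simp_all add: comp_assoc)
    moreover have "l = vsize (deg L t)"
      using Suc.hyps(2) t uu by (simp add: vsize_add vsize_axis)
    moreover have "deg L t = deg L t'" using Suc.prems t t' uu by simp
    ultimately have "t = t' \<and> z = z'"
      using Suc.prems t t' uu by (intro Suc.hyps(1)) simp_all
    then show ?case using t t' \<open>u = u' \<and> _\<close> by simp
  qed
  show ?thesis
    unfolding factorization_rule_def
  proof (intro ballI allI impI)
    fix x n m assume x: "x \<in> Mor L" "deg L x = n + m"
    then have "deg L x = m + n" by (simp add: add.commute)
    from split[OF x(1) this] obtain y z where yz: "y \<in> Mor L" "z \<in> Mor L" "src L y = rng L z" "deg L y = m"
      "deg L z = n" "x = y \<cdot> z"
      by blast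
    show "\<exists>!(y, z). y \<in> Mor L \<and> z \<in> Mor L \<and> src L y = rng L z \<and>
                   deg L y = m \<and> deg L z = n \<and> x = cmp L y z"
    proof (rule ex1I[of _ "(y, z)"], goal_cases)
      case (2 p)
      obtain u t where p: "p = (u, t)" by (cases p)
      have "u = y \<and> t = z"
        using 2 yz unfolding p prod.case by (intro same) (elim conjE, simp)+
      then show ?case by (simp add: p)
    qed (use yz in simp)
  qed
qed

end

section \<open>Higher-rank graphs\<close>

locale higher_rank_graph =
  fixes L :: "('a, 'k::finite) kgraph"
  assumes k_graph: "k_graph L"

sublocale higher_rank_graph \<subseteq> graded_category
  using k_graph by unfold_locales (auto simp: k_graph_def)

context higher_rank_graph
begin

lemma factor:
  assumes "x \<in> Mor L" "deg L x = m + n"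
  obtains y z where "y \<in> layer L m" "z \<in> layer L n" "src L y = rng L z" "x = y \<cdot> z"
proof -
  have "deg L x = n + m" using assms(2) by (simp add: add.commute)
  then have "\<exists>!(y, z). y \<in> Mor L \<and> z \<in> Mor L \<and> src L y = rng L z \<and>
                   deg L y = m \<and> deg L z = n \<and> x = cmp L y z"
    using k_graph assms(1) unfolding k_graph_def factorization_rule_def by blast
  then show ?thesis using that by (auto simp: layer_def)
qed

lemma factor_unique:
  assumes "y \<in> Mor L" "z \<in> Mor L" "y' \<in> Mor L" "z' \<in> Mor L" "src L y = rng L z"
    "src L y' = rng L z'" "deg L y = deg L y'" "y \<cdot> z = y' \<cdot> z'"
  shows "y = y' \<and> z = z'"
proof -
  have d: "deg L z = deg L z'"
    using assms by (metis add_left_cancel deg_comp)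
  have "deg L (y \<cdot> z) = deg L z + deg L y" using assms by (simp add: d add.commute)
  moreover have "y \<cdot> z \<in> Mor L" using assms by simp
  ultimately have "\<exists>!(u, t). u \<in> Mor L \<and> t \<in> Mor L \<and> src L u = rng L t \<and>
                   deg L u = deg L y \<and> deg L t = deg L z \<and> y \<cdot> z = cmp L u t"
    using k_graph unfolding k_graph_def factorization_rule_def by blast
  then obtain p where p: "\<And>u t. u \<in> Mor L \<Longrightarrow> t \<in> Mor L \<Longrightarrow> src L u = rng L t \<Longrightarrow>
      deg L u = deg L y \<Longrightarrow> deg L t = deg L z \<Longrightarrow> y \<cdot> z = u \<cdot> t \<Longrightarrow> (u, t) = p"
    by (elim ex1E) fast
  have "(y, z) = p" "(y', z') = p"
    using assms d by (intro p; simp)+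
  then show ?thesis by auto
qed

lemma degree_zero_identity:
  assumes "x \<in> Mor L" "deg L x = 0"
  shows "rng L x = x" "src L x = x"
  using factor_unique[of "rng L x" x x "src L x"] assms by auto

lemma vertex:
  assumes "v \<in> layer L 0"
  shows "v \<in> Mor L" "rng L v = v" "src L v = v" "deg L v = 0"
  using assms degree_zero_identity[of v] by (auto simp: layer_def)

lemma rng_layer_zero [simp]: "x \<in> Mor L \<Longrightarrow> rng L x \<in> layer L 0"
  and src_layer_zero [simp]: "x \<in> Mor L \<Longrightarrow> src L x \<in> layer L 0"
  by (simp_all add: layer_def)

lemma cancel_left:
  assumes "x \<cdot> y = x \<cdot> z" "x \<in> Mor L" "y \<in> Mor L" "z \<in> Mor L" "src L x = rng L y" "src L x = rng L z"
  shows "y = z"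
  using factor_unique[of x y x z] assms by simp

lemma first_edge:
  assumes "x \<in> Mor L" "0 < deg L x $ i"
  obtains y z where "y \<in> layer L (axis i 1)" "z \<in> Mor L" "src L y = rng L z" "x = y \<cdot> z"
proof -
  obtain m where "deg L x = axis i 1 + m"
    using axis_one_plus assms(2) by metis
  from factor[OF assms(1) this] show ?thesis
    using that by (metis layer_subset)
qed

end

section \<open>Isomorphic categories\<close>

text \<open>A bijection that respects the structure transports the axioms of a \<open>k\<close>-graph.\<close>

locale kgraph_iso = higher_rank_graph M for M :: "('m, 'k::finite) kgraph" +
  fixes Q :: "('q, 'k) kgraph" and \<phi> :: "'m \<Rightarrow> 'q"
  assumes bij: "bij_betw \<phi> (Mor M) (Mor Q)"
    and rng_hom: "x \<in> Mor M \<Longrightarrow> rng Q (\<phi> x) = \<phi> (rng M x)"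
    and src_hom: "x \<in> Mor M \<Longrightarrow> src Q (\<phi> x) = \<phi> (src M x)"
    and deg_hom: "x \<in> Mor M \<Longrightarrow> deg Q (\<phi> x) = deg M x"
    and cmp_hom: "x \<in> Mor M \<Longrightarrow> y \<in> Mor M \<Longrightarrow> src M x = rng M y \<Longrightarrow>
      cmp Q (\<phi> x) (\<phi> y) = \<phi> (cmp M x y)"
begin

lemma Mor_image: "Mor Q = \<phi> ` Mor M"
  using bij by (simp add: bij_betw_def)

lemma iso_eq_iff [simp]: "x \<in> Mor M \<Longrightarrow> y \<in> Mor M \<Longrightarrow> \<phi> x = \<phi> y \<longleftrightarrow> x = y"
  using bij by (auto simp: bij_betw_def inj_on_def)

lemma k_graph_iso: "k_graph Q"
  unfolding k_graph_def
proof (intro conjI)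
  show "category Q"
    unfolding category_def Mor_image
    by (auto simp: rng_hom src_hom cmp_hom comp_assoc)
  show "countable (Mor Q)"
    using k_graph by (auto simp: k_graph_def Mor_image)
  show "degree_functor Q"
    unfolding degree_functor_def Mor_image
    by (auto simp: rng_hom src_hom cmp_hom deg_hom)
  show "factorization_rule Q"
    unfolding factorization_rule_def
  proof (intro ballI allI impI)
    fix X n m assume X: "X \<in> Mor Q" "deg Q X = n + m"
    then obtain x where x: "x \<in> Mor M" "X = \<phi> x" by (auto simp: Mor_image)
    then have "deg M x = m + n" using X by (simp add: deg_hom add.commute)
    from factor[OF x(1) this] obtain y z where
      yz: "y \<in> layer M m" "z \<in> layer M n" "src M y = rng M z" "x = cmp M y z" by metis
    note yz' = layer_subset[OF yz(1)] layer_subset[OF yz(2)] layer_deg[OF yz(1)] layer_deg[OF yz(2)]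
    show "\<exists>!(Y, Z). Y \<in> Mor Q \<and> Z \<in> Mor Q \<and> src Q Y = rng Q Z \<and>
                   deg Q Y = m \<and> deg Q Z = n \<and> X = cmp Q Y Z"
    proof (rule ex1I[of _ "(\<phi> y, \<phi> z)"], goal_cases)
      case 1
      then show ?case using yz yz' by (simp add: Mor_image rng_hom src_hom cmp_hom deg_hom x)
    next
      case (2 p)
      obtain U T where p: "p = (U, T)" by (cases p)
      from 2 obtain u t where ut: "u \<in> Mor M" "U = \<phi> u" "t \<in> Mor M" "T = \<phi> t"
        unfolding p prod.case Mor_image by blast
      have "u = y \<and> t = z"
        using 2 yz yz' ut x unfolding p prod.case
        by (intro factor_unique) (elim conjE, simp add: rng_hom src_hom cmp_hom deg_hom)+
      then show ?case by (simp add: p ut)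
    qed
  qed
qed

lemma source_free_iso:
  assumes "source_free M"
  shows "source_free Q"
  unfolding source_free_def is_source_def
proof clarify
  fix V i assume V: "V \<in> layer Q 0" "{X \<in> layer Q (axis i 1). rng Q X = V} = {}"
  from V(1) obtain v where v: "v \<in> Mor M" "V = \<phi> v"
    unfolding layer_def Mor_image by blast
  have "v \<in> layer M 0" using V(1) deg_hom[OF v(1)] v by (simp add: layer_def)
  moreover have "\<not> is_source M v" using assms by (simp add: source_free_def)
  ultimately have "{x \<in> layer M (axis i 1). rng M x = v} \<noteq> {}" unfolding is_source_def by metis
  then obtain x where x: "x \<in> Mor M" "deg M x = axis i 1" "rng M x = v"
    by (auto simp only: layer_def)
  then have "\<phi> x \<in> {X \<in> layer Q (axis i 1). rng Q X = V}"
    by (simp add: layer_def Mor_image deg_hom rng_hom v(2))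
  with V(2) show False by blast
qed

end

section \<open>Presentations by coloured graphs\<close>

lemma walk_append:
  "walk G v (xs @ ys) \<longleftrightarrow> walk G v xs \<and> walk G (psrc G (v, xs)) ys"
proof (induction xs arbitrary: v)
  case Nil
  show ?case by (cases ys) (auto simp: psrc_def)
next
  case (Cons x xs)
  have "psrc G (v, x # xs) = psrc G (gsrc G x, xs)" by (simp add: psrc_def)
  then show ?case using Cons by simp
qed

text \<open>A \<open>k\<close>-graph \<open>M\<close> whose vertices and edges are labelled bijectively by those of a coloured
  graph \<open>G\<close>.\<close>

locale skeleton_labelling = higher_rank_graph M for M :: "('m, 'k::finite) kgraph" +
  fixes G :: "('v, 'e, 'k) cgraph" and V :: "'v \<Rightarrow> 'm" and E :: "'e \<Rightarrow> 'm"
  assumes vert_bij: "bij_betw V (gverts G) (layer M 0)"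
    and edge_bij: "bij_betw E (gedges G) (edges M)"
    and edge_rng: "x \<in> gedges G \<Longrightarrow> grng G x \<in> gverts G \<and> V (grng G x) = rng M (E x)"
    and edge_src: "x \<in> gedges G \<Longrightarrow> gsrc G x \<in> gverts G \<and> V (gsrc G x) = src M (E x)"
    and edge_deg: "x \<in> gedges G \<Longrightarrow> gdeg G x = deg M (E x)"
begin

text \<open>The composite in \<open>M\<close> of a walk, given by its range and the list of its edges.\<close>

primrec eval :: "'v \<Rightarrow> 'e list \<Rightarrow> 'm" where
  "eval v [] = V v"
| "eval v (x # xs) = cmp M (E x) (eval (gsrc G x) xs)"

lemma vert_layer [simp]: "v \<in> gverts G \<Longrightarrow> V v \<in> layer M 0"
  using vert_bij by (auto simp: bij_betw_def)

lemma vert_inject: "v \<in> gverts G \<Longrightarrow> w \<in> gverts G \<Longrightarrow> V v = V w \<longleftrightarrow> v = w"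
  using vert_bij by (auto simp: bij_betw_def inj_on_def)

lemma vert_surj: "u \<in> layer M 0 \<Longrightarrow> \<exists>v\<in>gverts G. u = V v"
  using vert_bij by (auto simp: bij_betw_def)

lemma edge_in [simp]: "x \<in> gedges G \<Longrightarrow> E x \<in> Mor M"
  using edge_bij by (auto simp: bij_betw_def edges_def)

lemma edge_inject: "x \<in> gedges G \<Longrightarrow> y \<in> gedges G \<Longrightarrow> E x = E y \<longleftrightarrow> x = y"
  using edge_bij by (auto simp: bij_betw_def inj_on_def)

lemma edge_surj: "y \<in> layer M (axis i 1) \<Longrightarrow> \<exists>x\<in>gedges G. y = E x"
  using edge_bij by (auto simp: bij_betw_def edges_iff_layer)

lemma edge_color:
  assumes "x \<in> gedges G"
  obtains i where "gdeg G x = axis i 1" "E x \<in> layer M (axis i 1)"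
proof -
  have "E x \<in> edges M" using assms edge_bij by (auto simp: bij_betw_def)
  then obtain i where i: "E x \<in> layer M (axis i 1)" unfolding edges_iff_layer by blast
  then show ?thesis using that[of i] edge_deg[OF assms] by (simp add: layer_deg)
qed

lemma walk_vert: "walk G v xs \<Longrightarrow> v \<in> gverts G"
  by (cases xs) auto

lemma eval_in:
  "walk G v xs \<Longrightarrow> eval v xs \<in> Mor M \<and> rng M (eval v xs) = V v \<and>
     src M (eval v xs) = V (psrc G (v, xs)) \<and> deg M (eval v xs) = pdeg G (v, xs) \<and>
     psrc G (v, xs) \<in> gverts G"
proof (induction xs arbitrary: v)
  case (Cons x xs)
  have "psrc G (v, x # xs) = psrc G (gsrc G x, xs)" by (simp add: psrc_def)
  then show ?case using Cons edge_rng[of x] edge_src[of x] edge_deg[of x] by (auto simp: pdeg_def)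
qed (simp add: psrc_def pdeg_def vertex)

lemma vsize_eval: "walk G v xs \<Longrightarrow> vsize (deg M (eval v xs)) = length xs"
proof (induction xs arbitrary: v)
  case (Cons x xs)
  then have x: "x \<in> gedges G" "walk G (gsrc G x) xs" by auto
  from edge_color[OF x(1)] obtain i where "E x \<in> layer M (axis i 1)" .
  then show ?case
    using Cons.IH[OF x(2)] eval_in[OF x(2)] x edge_src[of x]
    by (simp add: layer_deg vsize_add vsize_axis)
qed (simp add: vsize_def vertex)

lemma eval_append:
  "walk G v (xs @ ys) \<Longrightarrow> eval v (xs @ ys) = cmp M (eval v xs) (eval (psrc G (v, xs)) ys)"
proof (induction xs arbitrary: v)
  case Nil
  then show ?case using eval_in[of v ys] walk_vert[of v ys] comp_rng[of "eval v ys"]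
    by (simp add: psrc_def)
next
  case (Cons x xs)
  have p: "psrc G (v, x # xs) = psrc G (gsrc G x, xs)" by (simp add: psrc_def)
  from Cons.prems have w: "x \<in> gedges G" "walk G (gsrc G x) (xs @ ys)" by auto
  then have "walk G (gsrc G x) xs" "walk G (psrc G (gsrc G x, xs)) ys" by (auto simp: walk_append)
  then show ?case
    using Cons.IH[OF w(2)] w eval_in[of "gsrc G x" xs] eval_in[of "psrc G (gsrc G x, xs)" ys]
      edge_src[of x] comp_assoc[of "E x"]
    by (simp add: p)
qed

lemma eval_surj:
  assumes "x \<in> Mor M"
  shows "\<exists>v xs. walk G v xs \<and> eval v xs = x"
  using assms
proof (induction "vsize (deg M x)" arbitrary: x)
  case 0
  then have "x \<in> layer M 0" by (metis (mono_tags, lifting) layer_def mem_Collect_eq vsize_eq_0_iff)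
  from vert_surj[OF this] obtain v where "v \<in> gverts G" "x = V v" by blast
  then show ?case by (intro exI[of _ v] exI[of _ "[]"]) simp
next
  case (Suc n)
  then have "deg M x \<noteq> 0" by (auto simp: vsize_def)
  then obtain i where "0 < deg M x $ i" using nonzero_degree_component by blast
  from first_edge[OF Suc.prems this] obtain y z where
    y: "y \<in> layer M (axis i 1)" and z: "z \<in> Mor M" "src M y = rng M z" "x = cmp M y z" .
  from edge_surj[OF y] obtain e where e: "e \<in> gedges G" "y = E e" by blast
  have "n = vsize (deg M z)"
    using Suc.hyps(2) y z by (simp add: layer_deg layer_subset vsize_add vsize_axis)
  from Suc.hyps(1)[OF this z(1)] obtain v xs where xs: "walk G v xs" "eval v xs = z" by blast
  then have "V (gsrc G e) = V v" using edge_src[OF e(1)] eval_in[of v xs] z e by simp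
  then have "gsrc G e = v" using vert_inject edge_src[OF e(1)] walk_vert[OF xs(1)] by blast
  then show ?case
    using e xs z edge_rng[OF e(1)] by (intro exI[of _ "grng G e"] exI[of _ "e # xs"]) simp
qed

text \<open>The same for a path as a pair; this is the functor from the path category of \<open>G\<close> to \<open>M\<close>.\<close>

definition composite :: "('v, 'e) path \<Rightarrow> 'm" where
  "composite p = eval (fst p) (snd p)"

lemma paths_iff: "p \<in> paths G \<longleftrightarrow> walk G (fst p) (snd p)"
  by (simp add: paths_def case_prod_beta)

lemma composite_in:
  "p \<in> paths G \<Longrightarrow> composite p \<in> Mor M \<and> rng M (composite p) = V (fst p) \<and>
     src M (composite p) = V (psrc G p) \<and> deg M (composite p) = pdeg G p \<and>
     fst p \<in> gverts G \<and> psrc G p \<in> gverts G"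
  using eval_in[of "fst p" "snd p"] walk_vert[of "fst p" "snd p"]
  by (simp add: composite_def paths_iff)

lemma composite_pcat:
  assumes "p \<in> paths G" "q \<in> paths G" "psrc G p = fst q"
  shows "pcat p q \<in> paths G \<and> composite (pcat p q) = cmp M (composite p) (composite q)"
  using assms eval_append[of "fst p" "snd p" "snd q"]
  by (simp add: paths_iff composite_def pcat_def walk_append)

lemma composite_vertex: "v \<in> gverts G \<Longrightarrow> (v, []) \<in> paths G \<and> composite (v, []) = V v"
  by (simp add: paths_iff composite_def)

lemma composite_surj:
  assumes "x \<in> Mor M"
  obtains p where "p \<in> paths G" "composite p = x"
proof -
  from eval_surj[OF assms] obtain v xs where "walk G v xs" "eval v xs = x" by blast
  then show ?thesis using that[of "(v, xs)"] by (simp add: paths_iff composite_def)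
qed

lemma same_composite_ends:
  assumes "p \<in> paths G" "q \<in> paths G" "composite p = composite q"
  shows "fst p = fst q" "psrc G p = psrc G q"
  using assms composite_in[of p] composite_in[of q] vert_inject by metis+

lemma edge_path:
  assumes "x \<in> gedges G"
  shows "(grng G x, [x]) \<in> paths G" "composite (grng G x, [x]) = E x"
  using assms edge_rng[of x] edge_src[of x]
  by (simp_all add: paths_iff composite_def)

lemma path2_in:
  assumes "x \<in> gedges G" "y \<in> gedges G" "gsrc G x = grng G y"
  shows "path2 G x y \<in> paths G" "composite (path2 G x y) = cmp M (E x) (E y)"
  using assms edge_rng[of x] edge_src[of x] edge_rng[of y] edge_src[of y]
  by (simp_all add: paths_iff composite_def path2_def)

end

text \<open>A relation \<open>R\<close> on the paths of \<open>G\<close> presents \<open>M\<close> if it relates only paths with the same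
  composite in \<open>M\<close>, and generates all commuting squares of edges of distinct colours.\<close>

locale presentation = skeleton_labelling M G V E
  for M :: "('m, 'k::finite) kgraph" and G :: "('v, 'e, 'k) cgraph" and V :: "'v \<Rightarrow> 'm"
    and E :: "'e \<Rightarrow> 'm" +
  fixes R :: "('v, 'e) path \<Rightarrow> ('v, 'e) path \<Rightarrow> bool"
  assumes sound: "p \<in> paths G \<Longrightarrow> q \<in> paths G \<Longrightarrow> R p q \<Longrightarrow> composite p = composite q"
    and squares: "{x, y, x', y'} \<subseteq> gedges G \<Longrightarrow> gsrc G x = grng G y \<Longrightarrow> gsrc G y' = grng G x' \<Longrightarrow>
      gdeg G x = gdeg G x' \<Longrightarrow> gdeg G y = gdeg G y' \<Longrightarrow> gdeg G x \<noteq> gdeg G y \<Longrightarrow>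
      cmp M (E x) (E y) = cmp M (E y') (E x') \<Longrightarrow> path_cong G R (path2 G x y) (path2 G y' x')"
begin

lemma path_cong_sound:
  "path_cong G R p q \<Longrightarrow> p \<in> paths G \<and> q \<in> paths G \<and> composite p = composite q"
proof (induction rule: path_cong.induct)
  case (concat p2 q2 p1 q1)
  then show ?case using composite_pcat by simp
qed (simp_all add: sound)

lemma path_cong_Cons:
  assumes "x \<in> gedges G" "path_cong G R (gsrc G x, xs) (gsrc G x, ys)"
  shows "path_cong G R (grng G x, x # xs) (grng G x, x # ys)"
  using path_cong.concat[OF path_cong.refl[OF edge_path(1)[OF assms(1)], of R] assms(2)]
  by (simp add: psrc_def pcat_def)

text \<open>Walks with the same composite are congruent, by induction on their length. If their leftmost
  edges \<open>x\<close> and \<open>y\<close> have the same colour, these edges are equal by unique factorization. Otherwise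
  the composite is \<open>x y' r = y x' r\<close> for a commuting square \<open>x y' = y x'\<close>, the induction hypothesis
  turns the two walks into \<open>x y' zs\<close> and \<open>y x' zs\<close> for any walk \<open>zs\<close> with composite \<open>r\<close>, and
  the square exchanges these two.\<close>

lemma path_cong_if_eval_eq:
  "walk G v xs \<Longrightarrow> walk G v ys \<Longrightarrow> eval v xs = eval v ys \<Longrightarrow> path_cong G R (v, xs) (v, ys)"
proof (induction "length xs" arbitrary: v xs ys)
  case 0
  then have "length ys = 0" using vsize_eval by metis
  with 0 show ?case by (simp add: path_cong.refl paths_iff)
next
  case (Suc n)
  then have "length ys = Suc n" using vsize_eval by metis
  with Suc.hyps(2) obtain x xs' y ys' where xs: "xs = x # xs'" "ys = y # ys'" "length xs' = n"
    "length ys' = n" by (metis length_Suc_conv)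
  from Suc.prems xs have w: "x \<in> gedges G" "grng G x = v" "walk G (gsrc G x) xs'"
    "y \<in> gedges G" "grng G y = v" "walk G (gsrc G y) ys'"
    and eq: "cmp M (E x) (eval (gsrc G x) xs') = cmp M (E y) (eval (gsrc G y) ys')" by auto
  note xs'_in = eval_in[OF w(3)] and ys'_in = eval_in[OF w(6)]
  note ends = edge_rng[OF w(1)] edge_src[OF w(1)] edge_rng[OF w(4)] edge_src[OF w(4)]
  show ?case
  proof (cases "gdeg G x = gdeg G y")
    case True
    then have "E x = E y \<and> eval (gsrc G x) xs' = eval (gsrc G y) ys'"
      using xs'_in ys'_in ends eq w edge_deg by (intro factor_unique) auto
    then have "x = y" "eval (gsrc G x) xs' = eval (gsrc G x) ys'"
      using edge_inject w by auto
    then show ?thesis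
      using path_cong_Cons[OF w(1) Suc.hyps(1)[of xs' "gsrc G x" ys']] w xs by auto
  next
    case False
    from edge_color[OF w(1)] obtain i where i: "gdeg G x = axis i 1" "E x \<in> layer M (axis i 1)" .
    from edge_color[OF w(4)] obtain j where j: "gdeg G y = axis j 1" "E y \<in> layer M (axis j 1)" .
    have ij: "i \<noteq> j" using False i j by auto
    let ?p = "eval (gsrc G x) xs'" and ?q = "eval (gsrc G y) ys'"
    have "axis i 1 + deg M ?p = axis j 1 + deg M ?q"
      using arg_cong[OF eq, of "deg M"] xs'_in ys'_in ends w i j
      by (simp add: layer_deg)
    then have "(axis i 1 + deg M ?p) $ j = (axis j 1 + deg M ?q) $ j" by simp
    then have "0 < deg M ?p $ j" using ij by (simp add: axis_def)
    from first_edge[OF _ this] xs'_in obtain Y' r where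
      Y': "Y' \<in> layer M (axis j 1)" "r \<in> Mor M" "src M Y' = rng M r" "?p = cmp M Y' r" by blast
    note Y'_in = layer_subset[OF Y'(1)] layer_deg[OF Y'(1)]
    have xY': "src M (E x) = rng M Y'" using xs'_in ends Y' Y'_in by (metis rng_comp)
    then have "deg M (cmp M (E x) Y') = axis j 1 + axis i 1"
      using i w Y'_in by (simp add: layer_deg add.commute)
    moreover have "cmp M (E x) Y' \<in> Mor M" using w Y'_in xY' by simp
    ultimately obtain Y X where Y: "Y \<in> layer M (axis j 1)" and X: "X \<in> layer M (axis i 1)"
      and YX: "src M Y = rng M X" "cmp M (E x) Y' = cmp M Y X" using factor by metis
    note YX_in = layer_subset[OF Y] layer_deg[OF Y] layer_subset[OF X] layer_deg[OF X]
    have Xr: "src M X = rng M r"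
      using YX_in Y'_in YX Y'(3) xY' w src_comp[of Y X] src_comp[of "E x" Y'] edge_in[of x]
      by metis
    have "cmp M Y (cmp M X r) = cmp M (cmp M Y X) r"
      using YX_in YX(1) Xr Y' by (simp add: comp_assoc)
    also have "\<dots> = cmp M (E x) ?p"
      using YX_in Y'_in Y' xY' w by (simp add: YX(2)[symmetric] comp_assoc)
    finally have "cmp M Y (cmp M X r) = cmp M (E y) ?q" using eq by simp
    then have "Y = E y \<and> cmp M X r = ?q"
      using YX_in YX Xr Y' ys'_in ends w j by (intro factor_unique) (auto simp: layer_deg)
    then have Yy: "Y = E y" "cmp M X r = ?q" by auto
    from edge_surj[OF X] obtain x' where x': "x' \<in> gedges G" "X = E x'" by blast
    from edge_surj[OF Y'(1)] obtain y' where y': "y' \<in> gedges G" "Y' = E y'" by blast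
    from composite_surj[OF Y'(2)] obtain c where c: "c \<in> paths G" "composite c = r" .
    note ends' = edge_rng[OF x'(1)] edge_src[OF x'(1)] edge_rng[OF y'(1)] edge_src[OF y'(1)]
    note c_in = composite_in[OF c(1)]
    have v1: "gsrc G x = grng G y'" using vert_inject ends ends' xY' y' by metis
    have v2: "gsrc G y = grng G x'" using vert_inject ends ends' YX Yy x' by metis
    have v3: "gsrc G y' = fst c" using vert_inject c_in c ends' Y' y' by metis
    have v4: "gsrc G x' = fst c" using vert_inject c_in c ends' Xr x' by metis
    define zs where "zs = snd c"
    have c': "walk G (fst c) zs" "eval (fst c) zs = r" "(fst c, zs) \<in> paths G"
      using c by (simp_all add: paths_iff composite_def zs_def)
    have 1: "path_cong G R (v, x # xs') (v, x # y' # zs)"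
      using path_cong_Cons[OF w(1) Suc.hyps(1)[of xs' "gsrc G x" "y' # zs"]] w xs c' y' v1 v3 ends'
        Y'(4) by simp
    have 2: "path_cong G R (v, y # ys') (v, y # x' # zs)"
      using path_cong_Cons[OF w(4) Suc.hyps(1)[of ys' "gsrc G y" "x' # zs"]] w xs c' x' v2 v4 ends'
        Yy(2) by simp
    have "gdeg G x = gdeg G x'" "gdeg G y = gdeg G y'"
      using i j x' y' X Y' edge_deg by (simp_all add: layer_deg)
    then have "path_cong G R (path2 G x y') (path2 G y x')"
      using False w x' y' v1 v2 YX Yy(1) by (intro squares) auto
    then have "path_cong G R (pcat (path2 G x y') (fst c, zs)) (pcat (path2 G y x') (fst c, zs))"
      using v3 v4 c' by (intro path_cong.concat path_cong.refl) (simp_all add: path2_def psrc_def)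
    then have "path_cong G R (v, x # y' # zs) (v, y # x' # zs)"
      using w by (simp add: pcat_def path2_def)
    then show ?thesis
      using 1 2 xs by (blast intro: path_cong.trans path_cong.sym)
  qed
qed

lemma path_cong_iff:
  "path_cong G R p q \<longleftrightarrow> p \<in> paths G \<and> q \<in> paths G \<and> composite p = composite q"
proof
  assume pq: "p \<in> paths G \<and> q \<in> paths G \<and> composite p = composite q"
  then have "fst p = fst q" using same_composite_ends by blast
  with pq have "path_cong G R (fst p, snd p) (fst p, snd q)"
    by (intro path_cong_if_eval_eq) (auto simp: paths_iff composite_def)
  then show "path_cong G R p q" by (metis \<open>fst p = fst q\<close> prod.collapse)
qed (rule path_cong_sound)

text \<open>The paths with a given composite; these are the congruence classes.\<close>

definition fibre :: "'m \<Rightarrow> ('v, 'e) path set" where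
  "fibre x = {p \<in> paths G. composite p = x}"

lemma class_eq_fibre: "p \<in> paths G \<Longrightarrow> cong_rel G R `` {p} = fibre (composite p)"
  by (auto simp: cong_rel_def path_cong_iff fibre_def)

lemma fibre_nonempty: "x \<in> Mor M \<Longrightarrow> fibre x \<noteq> {}"
  using composite_surj[of x] unfolding fibre_def by blast

lemma UN_fibre:
  assumes "x \<in> Mor M" "\<And>p. p \<in> paths G \<Longrightarrow> composite p = x \<Longrightarrow> F p = Z"
  shows "(\<Union>p\<in>fibre x. F p) = Z"
  using assms fibre_nonempty[of x] by (auto simp: fibre_def)

lemma quotient_iso: "kgraph_iso M (path_quotient G R) fibre"
proof unfold_locales
  show "bij_betw fibre (Mor M) (Mor (path_quotient G R))"
    unfolding bij_betw_def
  proof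
    show "inj_on fibre (Mor M)"
      using fibre_nonempty by (auto simp: inj_on_def fibre_def)
    show "fibre ` Mor M = Mor (path_quotient G R)"
    proof (intro equalityI subsetI)
      fix X assume "X \<in> fibre ` Mor M"
      then obtain p where "p \<in> paths G" "X = fibre (composite p)"
        using composite_surj by (metis imageE)
      then show "X \<in> Mor (path_quotient G R)"
        by (simp add: path_quotient_def quotient_def flip: class_eq_fibre) blast
    next
      fix X assume "X \<in> Mor (path_quotient G R)"
      then show "X \<in> fibre ` Mor M"
        using composite_in by (auto simp: path_quotient_def quotient_def class_eq_fibre)
    qed
  qed
next
  fix x assume x: "x \<in> Mor M"
  show "rng (path_quotient G R) (fibre x) = fibre (rng M x)"
    unfolding path_quotient_def kgraph.simps
    using x composite_in composite_vertex class_eq_fibre by (intro UN_fibre) auto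
  show "src (path_quotient G R) (fibre x) = fibre (src M x)"
    unfolding path_quotient_def kgraph.simps
    using x composite_in composite_vertex class_eq_fibre by (intro UN_fibre) auto
  have "pdeg G ` fibre x = {deg M x}"
    using x composite_in fibre_nonempty[of x] by (force simp: fibre_def)
  then show "deg (path_quotient G R) (fibre x) = deg M x"
    by (simp add: path_quotient_def)
  fix y assume y: "y \<in> Mor M" "src M x = rng M y"
  show "cmp (path_quotient G R) (fibre x) (fibre y) = fibre (cmp M x y)"
    unfolding path_quotient_def kgraph.simps
  proof (intro UN_fibre x y)
    fix p q assume pq: "p \<in> paths G" "composite p = x" "q \<in> paths G" "composite q = y"
    then have "psrc G p = fst q"
      using composite_in[of p] composite_in[of q] y vert_inject by metis
    then show "cong_rel G R `` {pcat p q} = fibre (cmp M x y)"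
      using pq composite_pcat[of p q] by (simp add: class_eq_fibre)
  qed
qed

end

section \<open>Additive functions from edge weights\<close>

context higher_rank_graph
begin

lemma skeleton_labelling_self: "skeleton_labelling L (skeleton L) (\<lambda>x. x) (\<lambda>x. x)"
  by unfold_locales
    (auto simp: skeleton_def bij_betw_def inj_on_def edges_def)

text \<open>A weight of edges that agrees on opposite sides of commuting squares extends to an additive
  function of morphisms: the total weight of a walk is invariant under exchanging the two sides of
  a square, hence depends only on the composite of the walk.\<close>

lemma additive_extension:
  fixes w :: "'a \<Rightarrow> nat"
  assumes "\<And>x y x' y' i j. i \<noteq> j \<Longrightarrow> x \<in> layer L (axis i 1) \<Longrightarrow> x' \<in> layer L (axis i 1) \<Longrightarrow>
    y \<in> layer L (axis j 1) \<Longrightarrow> y' \<in> layer L (axis j 1) \<Longrightarrow> src L x = rng L y \<Longrightarrow>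
    src L y' = rng L x' \<Longrightarrow> x \<cdot> y = y' \<cdot> x' \<Longrightarrow> w x = w x'"
  shows "\<exists>N. (\<forall>x\<in>Mor L. \<forall>y\<in>Mor L. src L x = rng L y \<longrightarrow> N (x \<cdot> y) = N x + N y) \<and>
    (\<forall>x\<in>edges L. N x = w x)"
proof -
  let ?G = "skeleton L"
  define R where "R p q \<longleftrightarrow> (\<exists>x y x' y'. p = path2 ?G x y \<and> q = path2 ?G y' x' \<and>
    x \<in> edges L \<and> y \<in> edges L \<and> x' \<in> edges L \<and> y' \<in> edges L \<and> src L x = rng L y \<and> src L y' = rng L x' \<and>
    deg L x = deg L x' \<and> deg L y = deg L y' \<and> deg L x \<noteq> deg L y \<and> x \<cdot> y = y' \<cdot> x')" for p q
  have sk [simp]: "gedges ?G = edges L" "grng ?G = rng L" "gsrc ?G = src L" "gdeg ?G = deg L"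
    by (simp_all add: skeleton_def)
  interpret skeleton_labelling L ?G "\<lambda>x. x" "\<lambda>x. x" by (rule skeleton_labelling_self)
  interpret presentation L ?G "\<lambda>x. x" "\<lambda>x. x" R
  proof unfold_locales
    fix p q assume "R p q"
    then show "composite p = composite q" by (auto simp: R_def path2_in)
  next
    fix x y x' y' assume *: "{x, y, x', y'} \<subseteq> gedges ?G" "gsrc ?G x = grng ?G y"
      "gsrc ?G y' = grng ?G x'" "gdeg ?G x = gdeg ?G x'" "gdeg ?G y = gdeg ?G y'"
      "gdeg ?G x \<noteq> gdeg ?G y" "x \<cdot> y = y' \<cdot> x'"
    then have "R (path2 ?G x y) (path2 ?G y' x')" unfolding R_def sk by blast
    then show "path_cong ?G R (path2 ?G x y) (path2 ?G y' x')"
      using * by (intro path_cong.base path2_in) auto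
  qed
  define W where "W p = sum_list (map w (snd p))" for p :: "('a, 'a) path"
  have W_pcat: "W (pcat p q) = W p + W q" for p q by (simp add: W_def pcat_def)
  have W_square: "w x + w y = w y' + w x'"
    if sq: "x \<in> edges L" "y \<in> edges L" "x' \<in> edges L" "y' \<in> edges L" "src L x = rng L y"
      "src L y' = rng L x'" "deg L x = deg L x'" "deg L y = deg L y'" "deg L x \<noteq> deg L y"
      "x \<cdot> y = y' \<cdot> x'" for x y x' y'
  proof -
    obtain i where i: "x \<in> layer L (axis i 1)" using sq(1) edges_iff_layer by metis
    obtain j where j: "y \<in> layer L (axis j 1)" using sq(2) edges_iff_layer by metis
    note ij = i j
    have ij': "x' \<in> layer L (axis i 1)" "y' \<in> layer L (axis j 1)"
      using ij sq(3,4,7,8) by (simp_all add: layer_def)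
    have "i \<noteq> j" using ij sq(9) by (auto simp: layer_def)
    then have "w x = w x'" using ij ij' sq(5,6,10) by (intro assms)
    moreover have "w y' = w y"
      using \<open>i \<noteq> j\<close>[symmetric] ij ij' sq(5,6) sq(10)[symmetric] by (intro assms)
    ultimately show ?thesis by simp
  qed
  have W_R: "R p q \<Longrightarrow> W p = W q" for p q
    unfolding R_def
  proof (elim exE conjE, goal_cases)
    case (1 x y x' y')
    show ?case using W_square[OF 1(3-12)] by (simp add: 1(1,2) W_def path2_def)
  qed
  have W_cong: "path_cong ?G R p q \<Longrightarrow> W p = W q" for p q
  proof (induction rule: path_cong.induct)
    case (base p q)
    then show ?case using W_R by blast
  next
    case (trans p q u)
    then show ?case by simp
  next
    case (concat p2 q2 p1 q1)
    then show ?case by (simp add: W_pcat)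
  qed simp_all
  define P where "P x = (SOME p. p \<in> paths ?G \<and> composite p = x)" for x
  have P: "P x \<in> paths ?G \<and> composite (P x) = x" if "x \<in> Mor L" for x
    unfolding P_def using composite_surj[OF that] by (rule someI_ex) blast
  have W_P: "W (P x) = W p" if "p \<in> paths ?G" "composite p = x" for p x
    using that P[of x] composite_in[of p] by (intro W_cong) (auto simp: path_cong_iff)
  show ?thesis
  proof (rule exI[of _ "\<lambda>x. W (P x)"], intro conjI ballI impI)
    fix x y assume xy: "x \<in> Mor L" "y \<in> Mor L" "src L x = rng L y"
    then have "psrc ?G (P x) = fst (P y)"
      using P[of x] P[of y] composite_in[of "P x"] composite_in[of "P y"] by metis
    then have "W (P (x \<cdot> y)) = W (pcat (P x) (P y))"
      using xy P[of x] P[of y] composite_pcat[of "P x" "P y"] by (intro W_P) auto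
    then show "W (P (x \<cdot> y)) = W (P x) + W (P y)" by (simp add: W_pcat)
  next
    fix x assume "x \<in> edges L"
    then have "W (P x) = W (rng L x, [x])" using edge_path[of x] by (intro W_P) auto
    then show "W (P x) = w x" by (simp add: W_def)
  qed
qed

end

section \<open>The category of arrows between delayed edges\<close>

text \<open>A set \<open>D\<close> of edges of colour \<open>c\<close> that with each edge contains all edges parallel to it, that
  is, opposite to it in a commuting square whose other two sides have another colour.\<close>

locale parallel_closed = higher_rank_graph L for L :: "('a, 'k::finite) kgraph" +
  fixes c :: 'k and D :: "'a set"
  assumes D_layer: "D \<subseteq> layer L (axis c 1)"
    and parallel: "i \<noteq> c \<Longrightarrow> h \<in> layer L (axis c 1) \<Longrightarrow> g \<in> layer L (axis c 1) \<Longrightarrow>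
      a \<in> layer L (axis i 1) \<Longrightarrow> b \<in> layer L (axis i 1) \<Longrightarrow> src L h = rng L a \<Longrightarrow>
      src L b = rng L g \<Longrightarrow> cmp L h a = cmp L b g \<Longrightarrow> h \<in> D \<longleftrightarrow> g \<in> D"
begin

lemma D_in: "g \<in> D \<Longrightarrow> g \<in> Mor L \<and> deg L g = axis c 1"
  using D_layer by (auto simp: layer_def)

text \<open>The number of edges in \<open>D\<close> on any walk with the given composite.\<close>

definition count :: "'a \<Rightarrow> nat" where
  "count = (SOME N. (\<forall>x\<in>Mor L. \<forall>y\<in>Mor L. src L x = rng L y \<longrightarrow> N (cmp L x y) = N x + N y) \<and>
    (\<forall>x\<in>edges L. N x = (if x \<in> D then 1 else 0)))"

lemma count_spec:
  "(\<forall>x\<in>Mor L. \<forall>y\<in>Mor L. src L x = rng L y \<longrightarrow> count (cmp L x y) = count x + count y) \<and>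
    (\<forall>x\<in>edges L. count x = (if x \<in> D then 1 else 0))"
proof -
  have "\<exists>N :: 'a \<Rightarrow> nat. (\<forall>x\<in>Mor L. \<forall>y\<in>Mor L. src L x = rng L y \<longrightarrow> N (cmp L x y) = N x + N y) \<and>
    (\<forall>x\<in>edges L. N x = (if x \<in> D then 1 else 0))"
  proof (rule additive_extension)
    fix x y x' y' i j
    assume *: "i \<noteq> j" "x \<in> layer L (axis i 1)" "x' \<in> layer L (axis i 1)" "y \<in> layer L (axis j 1)"
      "y' \<in> layer L (axis j 1)" "src L x = rng L y" "src L y' = rng L x'" "cmp L x y = cmp L y' x'"
    have "x \<in> D \<longleftrightarrow> x' \<in> D"
    proof (cases "i = c")
      case True
      then show ?thesis using * parallel[of j x x' y y'] by auto
    next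
      case False
      then show ?thesis using * D_in by (auto simp: layer_def axis_one_inject)
    qed
    then show "(if x \<in> D then 1 else 0) = (if x' \<in> D then 1 else 0 :: nat)" by simp
  qed
  then show ?thesis unfolding count_def by (rule someI_ex)
qed

lemma count_comp [simp]:
  "x \<in> Mor L \<Longrightarrow> y \<in> Mor L \<Longrightarrow> src L x = rng L y \<Longrightarrow> count (cmp L x y) = count x + count y"
  using count_spec by blast

lemma count_edge: "x \<in> layer L (axis i 1) \<Longrightarrow> count x = (if x \<in> D then 1 else 0)"
  using count_spec edges_iff_layer by metis

lemma count_D: "g \<in> D \<Longrightarrow> count g = 1"
  using count_edge[of g c] D_layer by auto

lemma count_vertex: "v \<in> layer L 0 \<Longrightarrow> count v = 0"
  using count_comp[of v v] vertex[of v] comp_rng[of v] by (metis add_cancel_right_right)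

lemma count_le: "x \<in> Mor L \<Longrightarrow> count x \<le> deg L x $ c"
proof (induction "vsize (deg L x)" arbitrary: x)
  case 0
  then have "x \<in> layer L 0" by (metis (mono_tags, lifting) layer_def mem_Collect_eq vsize_eq_0_iff)
  then show ?case by (simp add: count_vertex)
next
  case (Suc n)
  then have "deg L x \<noteq> 0" by (auto simp: vsize_def)
  then obtain i where "0 < deg L x $ i" using nonzero_degree_component by blast
  from first_edge[OF Suc.prems this] obtain y z where
    y: "y \<in> layer L (axis i 1)" and z: "z \<in> Mor L" "src L y = rng L z" "x = cmp L y z" .
  note y' = layer_subset[OF y] layer_deg[OF y]
  have "n = vsize (deg L z)" using Suc.hyps(2) y' z by (simp add: vsize_add vsize_axis)
  then have "count z \<le> deg L z $ c" using Suc.hyps(1) z by blast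
  moreover have "count y \<le> deg L y $ c"
  proof (cases "y \<in> D")
    case True
    then show ?thesis using D_in count_D by (simp add: axis_def)
  qed (simp add: count_edge[OF y])
  ultimately show ?case using y' z by simp
qed

text \<open>The objects of the category of arrows. An old vertex is its identity morphism; the new vertex
  in the middle of \<open>g \<in> D\<close> is \<open>g\<close>.\<close>

definition objs :: "'a set" where
  "objs = layer L 0 \<union> D"

lemma objs_in: "v \<in> objs \<Longrightarrow> v \<in> Mor L"
  by (auto simp: objs_def layer_def D_in)

lemma objs_cases:
  assumes "v \<in> objs"
  obtains (zero) "v \<in> layer L 0" "v \<notin> D" "rng L v = v" "src L v = v" "deg L v = 0" "count v = 0"
  | (delayed) "v \<in> D" "v \<in> layer L (axis c 1)" "deg L v = axis c 1" "count v = 1"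
proof (cases "v \<in> D")
  case True
  then show ?thesis using delayed D_in[of v] count_D[of v] D_layer by blast
next
  case False
  then have "v \<in> layer L 0" using assms by (simp add: objs_def)
  then show ?thesis using False by (intro zero) (simp_all add: vertex count_vertex)
qed

text \<open>The full subcategory, on the objects \<open>objs\<close>, of the category of arrows of \<open>L\<close>. A morphism
  \<open>(v, m, n, w)\<close> from \<open>w\<close> to \<open>v\<close> is a commuting square \<open>m w = v n\<close>. Its degree is that of \<open>m\<close>
  plus one step of colour \<open>c\<close> for each edge of \<open>n\<close> in \<open>D\<close>. With \<open>g \<in> D\<close>, its edges of colour \<open>c\<close>
  are thus \<open>(g, g, src g, src g)\<close> and \<open>(rng g, rng g, g, g)\<close>, the two halves of \<open>g\<close>, and
  \<open>(rng x, x, x, src x)\<close> for the edges \<open>x\<close> of colour \<open>c\<close> that are not in \<open>D\<close>.\<close>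

definition arrow_graph :: "('a \<times> 'a \<times> 'a \<times> 'a, 'k) kgraph" where
  "arrow_graph =
     \<lparr> Mor = {(v, m, n, w). v \<in> objs \<and> w \<in> objs \<and> m \<in> Mor L \<and> n \<in> Mor L \<and>
         rng L m = rng L v \<and> src L m = rng L w \<and> rng L n = src L v \<and> src L n = src L w \<and>
         cmp L m w = cmp L v n},
       rng = (\<lambda>(v, m, n, w). (v, rng L v, src L v, v)),
       src = (\<lambda>(v, m, n, w). (w, rng L w, src L w, w)),
       cmp = (\<lambda>(v, m, n, w) (v', m', n', w'). (v, cmp L m m', cmp L n n', w')),
       deg = (\<lambda>(v, m, n, w). deg L m + axis c (count n)) \<rparr>"

lemma arrow_in_iff:
  "(v, m, n, w) \<in> Mor arrow_graph \<longleftrightarrow> v \<in> objs \<and> w \<in> objs \<and> m \<in> Mor L \<and> n \<in> Mor L \<and>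
     rng L m = rng L v \<and> src L m = rng L w \<and> rng L n = src L v \<and> src L n = src L w \<and>
     cmp L m w = cmp L v n"
  by (simp add: arrow_graph_def)

lemma arrow_sel [simp]:
  "rng arrow_graph (v, m, n, w) = (v, rng L v, src L v, v)"
  "src arrow_graph (v, m, n, w) = (w, rng L w, src L w, w)"
  "cmp arrow_graph (v, m, n, w) (v', m', n', w') = (v, cmp L m m', cmp L n n', w')"
  "deg arrow_graph (v, m, n, w) = deg L m + axis c (count n)"
  by (simp_all add: arrow_graph_def)

lemma arrow_graded: "graded_category arrow_graph"
proof
  show "category arrow_graph"
    unfolding category_def
  proof (intro conjI ballI impI)
    fix x y assume "x \<in> Mor arrow_graph" "y \<in> Mor arrow_graph" "src arrow_graph x = rng arrow_graph y"
    moreover obtain v m n w where x: "x = (v, m, n, w)" by (metis prod.exhaust)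
    moreover obtain v' m' n' w' where y: "y = (v', m', n', w')" by (metis prod.exhaust)
    ultimately have *: "(v, m, n, w) \<in> Mor arrow_graph" "(w, m', n', w') \<in> Mor arrow_graph" "v' = w"
      by auto
    have "cmp L (cmp L m m') w' = cmp L m (cmp L w n')"
      using * objs_in by (simp add: arrow_in_iff comp_assoc)
    also have "\<dots> = cmp L (cmp L v n) n'"
      using * objs_in by (simp add: arrow_in_iff comp_assoc[symmetric])
    also have "\<dots> = cmp L v (cmp L n n')"
      using * objs_in by (simp add: arrow_in_iff comp_assoc)
    finally show "cmp arrow_graph x y \<in> Mor arrow_graph"
      using * objs_in by (simp add: x y arrow_in_iff)
    show "rng arrow_graph (cmp arrow_graph x y) = rng arrow_graph x"
      "src arrow_graph (cmp arrow_graph x y) = src arrow_graph y" by (simp_all add: x y)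
  qed (use objs_in in \<open>auto simp: arrow_in_iff comp_assoc comp_rng_eq comp_src_eq\<close>)
  show "degree_functor arrow_graph"
    unfolding degree_functor_def
    by (auto simp: arrow_in_iff objs_in count_vertex vec_eq_iff axis_def)
qed

sublocale arrow: graded_category arrow_graph
  by (rule arrow_graded)

lemma axis_c_component [simp]: "axis c (n :: nat) $ c = n" "i \<noteq> c \<Longrightarrow> axis c n $ i = 0"
  by (simp_all add: axis_def)

lemma objs_deg_le: "v \<in> objs \<Longrightarrow> deg L v $ j \<le> axis c 1 $ j"
  by (elim objs_cases) simp_all

lemma objs_count: "v \<in> objs \<Longrightarrow> count v = (if v \<in> D then 1 else 0)"
  by (elim objs_cases) simp_all

lemma arrow_balance:
  assumes "(v, m, n, w) \<in> Mor arrow_graph"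
  shows "deg L m + deg L w = deg L v + deg L n" "count m + count w = count v + count n"
proof -
  have "m \<in> Mor L" "w \<in> Mor L" "src L m = rng L w" "v \<in> Mor L" "n \<in> Mor L" "src L v = rng L n"
    "cmp L m w = cmp L v n" using assms objs_in by (auto simp: arrow_in_iff)
  then show "deg L m + deg L w = deg L v + deg L n" "count m + count w = count v + count n"
    using deg_comp count_comp by metis+
qed

lemma arrow_degree_zero:
  assumes "X \<in> Mor arrow_graph" "deg arrow_graph X = 0"
  shows "rng arrow_graph X = X"
proof -
  obtain v m n w where X: "X = (v, m, n, w)" by (metis prod.exhaust)
  from assms have in': "v \<in> objs" "w \<in> objs" "m \<in> Mor L" "n \<in> Mor L" "rng L m = rng L v"
    "src L m = rng L w" "rng L n = src L v" "src L n = src L w" "cmp L m w = cmp L v n"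
    by (simp_all add: X arrow_in_iff)
  have "deg L m $ i + axis c (count n) $ i = 0" for i
    using assms(2) by (simp add: X vec_eq_iff)
  then have "deg L m $ i = 0" "axis c (count n) $ c = 0" for i
    by (simp_all only: add_is_0)
  then have m: "deg L m = 0" and n: "count n = 0" by (simp_all add: vec_eq_iff)
  have m': "m = rng L v" "m = rng L w"
    using degree_zero_identity[OF in'(3) m] in' by simp_all
  then have w: "w = cmp L v n" using in' objs_in by (metis comp_rng)
  have "v = w \<and> n = src L v"
    using in'(1)
  proof (cases rule: objs_cases)
    case zero
    then have "w = n" using w in' by (metis comp_rng)
    with n in'(2) have "w \<in> layer L 0" by (auto simp: objs_def count_D)
    then show ?thesis using m' zero \<open>w = n\<close> vertex by metis
  next
    case delayed
    have "deg L w = axis c 1 + deg L n" using w in' delayed objs_in by simp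
    then have "axis c 1 $ j + deg L n $ j \<le> axis c 1 $ j" for j
      using objs_deg_le[OF in'(2), of j] by simp
    then have "deg L n = 0" by (simp add: vec_eq_iff)
    then have "n = src L v" using degree_zero_identity[OF in'(4)] in' by simp
    then show ?thesis using w in' objs_in by simp
  qed
  then show ?thesis using m' by (simp add: X)
qed

text \<open>An edge of another colour is a commuting square of \<open>L\<close> with sides of that colour; it
  degenerates to an edge of \<open>L\<close> if \<open>v\<close> and \<open>g\<close> are vertices.\<close>

lemma arrow_other_edge:
  assumes "(v, b, a, g) \<in> Mor arrow_graph" "deg arrow_graph (v, b, a, g) = axis i 1" "i \<noteq> c"
  shows "b \<in> layer L (axis i 1)" "a \<in> layer L (axis i 1)" "deg L g = deg L v"
proof -
  from assms have in': "v \<in> objs" "g \<in> objs" "b \<in> Mor L" "a \<in> Mor L" "rng L b = rng L v"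
    "src L b = rng L g" "rng L a = src L v" "src L a = src L g" "cmp L b g = cmp L v a"
    by (simp_all add: arrow_in_iff)
  have d: "deg L b + axis c (count a) = axis i 1" using assms(2) by simp
  from arg_cong[OF this, of "\<lambda>n. n $ c"] have "deg L b $ c + count a = 0"
    using assms(3) by (simp add: axis_def)
  then have a: "count a = 0" "count b = 0" using count_le[OF in'(3)] by simp_all
  have b: "deg L b = axis i 1" using d a by (simp add: axis_def vec_eq_iff)
  have "deg L b + deg L g = deg L v + deg L a" "count b + count g = count v + count a"
    using arrow_balance[OF assms(1)] by simp_all
  then have e: "axis i 1 + deg L g = deg L v + deg L a" "count g = count v" using a b by simp_all
  show g: "deg L g = deg L v"
    using e(2) in'(1,2) by (elim objs_cases) auto
  show "b \<in> layer L (axis i 1)" using b in' by (simp add: layer_def)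
  show "a \<in> layer L (axis i 1)" using e(1) g in' by (simp add: layer_def) (metis add.commute add_left_cancel)
qed

lemma arrow_c_edge:
  assumes "(v, b, a, u) \<in> Mor arrow_graph" "deg arrow_graph (v, b, a, u) = axis c 1"
  obtains (old) "v \<in> layer L 0" "v = rng L b" "b \<in> layer L (axis c 1)" "b \<notin> D" "a = b" "u = src L b"
  | (fst) "v \<in> D" "b = v" "a = src L v" "u = src L v"
  | (snd) "v \<in> layer L 0" "u \<in> D" "v = rng L u" "b = v" "a = u"
proof -
  from assms have in': "v \<in> objs" "u \<in> objs" "b \<in> Mor L" "a \<in> Mor L" "rng L b = rng L v"
    "src L b = rng L u" "rng L a = src L v" "src L a = src L u" "cmp L b u = cmp L v a"
    by (simp_all add: arrow_in_iff)
  have d: "deg L b + axis c (count a) = axis c 1" using assms(2) by simp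
  have di: "deg L b $ i + axis c (count a) $ i = axis c 1 $ i" for i using d by (metis vector_add_component)
  then have bi: "i \<noteq> c \<Longrightarrow> deg L b $ i = 0" for i by (metis add_is_0 axis_c_component(2))
  have bc: "deg L b $ c + count a = 1" using di[of c] by simp
  have eq: "deg L b + deg L u = deg L v + deg L a"
    "count b + count u = count v + count a"
    using arrow_balance[OF assms(1)] by simp_all
  consider "deg L b $ c = 0" "count a = 1" | "deg L b $ c = 1" "count a = 0" using bc by linarith
  then show thesis
  proof cases
    case 1
    then have b: "deg L b = 0" using bi by (metis vec_eq_iff zero_index)
    then have b': "b = rng L v" "b = rng L u" using degree_zero_identity[OF in'(3)] in' by simp_all
    have "count b = 0" using 1 count_le[OF in'(3)] by simp
    then have "count u = count v + 1" using eq(2) 1 by simp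
    then have vu: "v \<in> layer L 0" "u \<in> D"
      using in'(1,2) objs_count by (auto simp: objs_def split: if_splits)
    have bv: "b = v" using b' vertex(2)[OF vu(1)] by simp
    have "cmp L b u = u" "cmp L v a = a"
      using b'(2) in' objs_in vertex(3)[OF vu(1)] comp_rng[of u] comp_rng[of a] by simp_all
    then have "a = u" using in'(9) by metis
    moreover have "v = rng L u" using b' bv by metis
    ultimately show thesis using snd vu bv by blast
  next
    case 2
    have b: "deg L b = axis c 1" using 2 bi by (auto simp: vec_eq_iff axis_def)
    then have bl: "b \<in> layer L (axis c 1)" using in' by (simp add: layer_def)
    from in'(1) show thesis
    proof (cases rule: objs_cases)
      case zero
      then have "count b = 0" "count u = 0" using eq(2) 2 by simp_all
      then have u: "u \<in> layer L 0" and bD: "b \<notin> D"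
        using in'(2) by (auto simp: objs_def count_D)
      have ub: "u = src L b" using in'(6) vertex(2)[OF u] by simp
      have "cmp L b u = b" "cmp L v a = a"
        using ub in'(3,4,7) zero(4) comp_src comp_rng by metis+
      then have "a = b" using in'(9) by metis
      moreover have "v = rng L b" using in'(5) zero(3) by metis
      ultimately show thesis using old bl bD ub zero(1) by blast
    next
      case delayed
      have bv: "b = v \<and> u = a"
        by (rule factor_unique) (use in' b delayed(3) objs_in in simp_all)
      have u: "u \<in> layer L 0" using in'(2) 2(2) bv by (auto simp: objs_def count_D)
      then have "u = src L v" using bv in'(6) vertex(2) by metis
      then show thesis using fst delayed(1) bv by blast
    qed
  qed
qed

text \<open>The leftmost edge \<open>(v, b, a, u)\<close> of a morphism is determined by its colour. In colour \<open>c\<close> with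
  \<open>v\<close> a vertex, \<open>a\<close> is the leftmost edge of that colour of the third component, and membership
  of \<open>a\<close> in \<open>D\<close> decides between half an edge and an old edge.\<close>

lemma arrow_first_edge_unique:
  assumes "Y \<in> layer arrow_graph (axis i 1)" "Y' \<in> layer arrow_graph (axis i 1)"
    "Z \<in> Mor arrow_graph" "Z' \<in> Mor arrow_graph"
    "src arrow_graph Y = rng arrow_graph Z" "src arrow_graph Y' = rng arrow_graph Z'"
    "cmp arrow_graph Y Z = cmp arrow_graph Y' Z'"
  shows "Y = Y' \<and> Z = Z'"
proof -
  obtain v b a u where Y: "Y = (v, b, a, u)" by (metis prod.exhaust)
  obtain v' b' a' u' where Y': "Y' = (v', b', a', u')" by (metis prod.exhaust)
  obtain t m n w where Z: "Z = (t, m, n, w)" by (metis prod.exhaust)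
  obtain t' m' n' w' where Z': "Z' = (t', m', n', w')" by (metis prod.exhaust)
  from assms have eq: "t = u" "t' = u'" "v' = v" "w' = w" "cmp L b m = cmp L b' m'"
    "cmp L a n = cmp L a' n'" by (auto simp: Y Y' Z Z')
  from assms have deg: "deg arrow_graph (v, b, a, u) = axis i 1"
    "deg arrow_graph (v, b', a', u') = axis i 1"
    and in1: "(v, b, a, u) \<in> Mor arrow_graph" "(v, b', a', u') \<in> Mor arrow_graph"
    "(u, m, n, w) \<in> Mor arrow_graph" "(u', m', n', w) \<in> Mor arrow_graph"
    by (auto simp: layer_def Y Y' Z Z' eq)
  note in2 = in1[unfolded arrow_in_iff]
  have same: "a = a' \<and> b = b' \<and> u = u'"
  proof (cases "i = c")
    case False
    note y = arrow_other_edge[OF in1(1) deg(1) False] and y' = arrow_other_edge[OF in1(2) deg(2) False]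
    have an: "a = a' \<and> n = n'"
      by (rule factor_unique) (use in2 y y' eq in \<open>simp_all add: layer_deg\<close>)
    have bm: "b = b' \<and> m = m'"
      by (rule factor_unique) (use in2 y y' eq in \<open>simp_all add: layer_deg\<close>)
    have "u = u'"
      using in2 objs_in an bm by (intro cancel_left[of b u u']) auto
    with an bm show ?thesis by simp
  next
    case True
    note y = in1(1) deg(1)[unfolded True] and y' = in1(2) deg(2)[unfolded True]
    have v: "v \<in> objs" using in2 by blast
    then show ?thesis
    proof (cases rule: objs_cases)
      case zero
      have A: "a \<in> layer L (axis c 1) \<and> (if a \<in> D then b = v \<and> u = a else b = a \<and> u = src L a)"
        using y zero D_layer by (cases rule: arrow_c_edge) auto
      have A': "a' \<in> layer L (axis c 1) \<and> (if a' \<in> D then b' = v \<and> u' = a' else b' = a' \<and> u' = src L a')"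
        using y' zero D_layer by (cases rule: arrow_c_edge) auto
      have "deg L a = deg L a'" using A A' layer_deg by metis
      then have "a = a' \<and> n = n'"
        by (intro factor_unique) (use in2 eq(6) in simp_all)
      then show ?thesis using A A' by (simp split: if_splits)
    next
      case delayed
      have "v \<notin> layer L 0" using delayed by (auto simp: layer_def vec_eq_iff axis_def)
      then have "b = v \<and> a = src L v \<and> u = src L v" "b' = v \<and> a' = src L v \<and> u' = src L v"
        using y y' by (auto elim!: arrow_c_edge)
      then show ?thesis by simp
    qed
  qed
  then have "m = m'" "n = n'"
    using in2 eq by (auto intro: cancel_left)
  with same show ?thesis by (simp add: Y Y' Z Z' eq)
qed

text \<open>An edge of another colour whose range is the source of \<open>v\<close> is carried along \<open>v\<close>.\<close>

lemma arrow_other_edge_in: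
  assumes "i \<noteq> c" "v \<in> objs" "a \<in> layer L (axis i 1)" "rng L a = src L v"
  obtains b g where "b \<in> layer L (axis i 1)" "g \<in> objs" "deg L g = deg L v" "src L b = rng L g"
    "cmp L b g = cmp L v a" "(v, b, a, g) \<in> layer arrow_graph (axis i 1)"
proof -
  note a = layer_subset[OF assms(3)] layer_deg[OF assms(3)] and v = objs_in[OF assms(2)]
  have "deg L (cmp L v a) = axis i 1 + deg L v"
    using a v assms(4) by (simp add: add.commute)
  moreover have "cmp L v a \<in> Mor L" using a v assms(4) by simp
  ultimately obtain b g where b: "b \<in> layer L (axis i 1)" and g: "g \<in> layer L (deg L v)"
    and bg: "src L b = rng L g" "cmp L v a = cmp L b g" using factor by metis
  note b' = layer_subset[OF b] layer_deg[OF b] and g' = layer_subset[OF g] layer_deg[OF g]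
  have "g \<in> objs"
    using assms(2)
  proof (cases rule: objs_cases)
    case zero
    then show ?thesis using g by (simp add: objs_def)
  next
    case delayed
    then have "g \<in> D" using parallel[OF assms(1), of v g a b] assms b g bg by simp
    then show ?thesis by (simp add: objs_def)
  qed
  have ends: "rng L b = rng L v" "src L a = src L g"
    using bg a b' g' v assms(4) rng_comp[of v a] rng_comp[of b g] src_comp[of v a] src_comp[of b g]
    by metis+
  have "count a = 0"
    using count_le[OF a(1)] a(2) assms(1) by (simp add: axis_def)
  then have "(v, b, a, g) \<in> layer arrow_graph (axis i 1)"
    using a b' g' v bg ends assms \<open>g \<in> objs\<close> by (simp add: layer_def arrow_in_iff vec_eq_iff axis_def)
  then show thesis using that b g' bg \<open>g \<in> objs\<close> by metis
qed

lemma arrow_old_edge_in: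
  assumes "b \<in> layer L (axis i 1)" "b \<notin> D"
  shows "(rng L b, b, b, src L b) \<in> layer arrow_graph (axis i 1)"
  using assms count_edge[OF assms(1)] layer_subset[OF assms(1)] layer_deg[OF assms(1)]
  by (simp add: layer_def[of arrow_graph] arrow_in_iff objs_def vec_eq_iff axis_def)

lemma arrow_fst_edge_in:
  assumes "g \<in> D"
  shows "(g, g, src L g, src L g) \<in> layer arrow_graph (axis c 1)"
  using assms D_in[OF assms]
  by (simp add: layer_def[of arrow_graph] arrow_in_iff objs_def count_vertex vec_eq_iff axis_def)

lemma arrow_snd_edge_in:
  assumes "g \<in> D"
  shows "(rng L g, rng L g, g, g) \<in> layer arrow_graph (axis c 1)"
  using assms D_in[OF assms] count_D[OF assms]
  by (simp add: layer_def[of arrow_graph] arrow_in_iff objs_def vec_eq_iff axis_def)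

lemma arrow_first_edge:
  assumes "X \<in> Mor arrow_graph" "0 < deg arrow_graph X $ i"
  shows "\<exists>Y Z. Y \<in> layer arrow_graph (axis i 1) \<and> Z \<in> Mor arrow_graph \<and>
    src arrow_graph Y = rng arrow_graph Z \<and> X = cmp arrow_graph Y Z"
proof -
  obtain v m n w where X: "X = (v, m, n, w)" by (metis prod.exhaust)
  from assms have in': "v \<in> objs" "w \<in> objs" "m \<in> Mor L" "n \<in> Mor L" "rng L m = rng L v"
    "src L m = rng L w" "rng L n = src L v" "src L n = src L w" "cmp L m w = cmp L v n"
    by (simp_all add: X arrow_in_iff)
  note vw = objs_in[OF in'(1)] objs_in[OF in'(2)]
  have eq: "deg L m $ j + deg L w $ j = deg L v $ j + deg L n $ j"
    "count m + count w = count v + count n" for j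
    using arrow_balance[OF assms(1)[unfolded X]] by (metis vector_add_component)+
  have pos: "0 < deg L m $ i + axis c (count n) $ i" using assms(2) by (simp add: X)
  show ?thesis
  proof (cases "i = c")
    case False
    have "0 < deg L n $ i"
      using False pos eq(1)[of i] in'(1,2) by (elim objs_cases) auto
    from first_edge[OF in'(4) this] obtain a n' where
      a: "a \<in> layer L (axis i 1)" and n': "n' \<in> Mor L" "src L a = rng L n'" "n = cmp L a n'" .
    note a' = layer_subset[OF a]
    have "rng L a = src L v" using in'(7) n' a' by simp
    from arrow_other_edge_in[OF False in'(1) a this] obtain b g where
      b: "b \<in> layer L (axis i 1)" and g: "g \<in> objs" "src L b = rng L g" "cmp L b g = cmp L v a"
      and Y: "(v, b, a, g) \<in> layer arrow_graph (axis i 1)" by metis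
    have Y': "rng L b = rng L v" "rng L a = src L v" "src L a = src L g"
      using layer_subset[OF Y] by (simp_all add: arrow_in_iff)
    note b' = layer_subset[OF b] layer_deg[OF b] objs_in[OF g(1)]
    have "0 < deg L m $ i" using False pos by simp
    from first_edge[OF in'(3) this] obtain b0 m' where
      b0: "b0 \<in> layer L (axis i 1)" and m': "m' \<in> Mor L" "src L b0 = rng L m'" "m = cmp L b0 m'" .
    note b0' = layer_subset[OF b0] layer_deg[OF b0]
    have sm: "src L m' = rng L w" using in'(6) m' b0' by simp
    have "cmp L b0 (cmp L m' w) = cmp L m w" using m' b0' sm vw by (simp add: comp_assoc)
    also have "\<dots> = cmp L (cmp L b g) n'"
      using in'(9) n' a' Y' vw g by (simp add: comp_assoc)
    also have "\<dots> = cmp L b (cmp L g n')" using g b' n' Y' by (intro comp_assoc) auto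
    finally have "b0 = b \<and> cmp L m' w = cmp L g n'"
      using b0' b' m' n' sm vw g Y' by (intro factor_unique) auto
    then have "(g, m', n', w) \<in> Mor arrow_graph"
      using g in' m' n' sm b0' a' Y' by (auto simp: arrow_in_iff)
    then show ?thesis using Y \<open>b0 = b \<and> _\<close> m' n'
      by (intro exI[of _ "(v, b, a, g)"] exI[of _ "(g, m', n', w)"]) (simp add: X)
  next
    case True
    have pos: "0 < deg L m $ c + count n" using pos True by simp
    from in'(1) show ?thesis
    proof (cases rule: objs_cases)
      case zero
      have n: "n = cmp L m w" using in' zero by (metis comp_rng)
      have "0 < deg L n $ c" using pos eq(1)[of c] zero count_le[OF in'(4)] by simp linarith
      from first_edge[OF in'(4) this] obtain h n' where
        h: "h \<in> layer L (axis c 1)" and n': "n' \<in> Mor L" "src L h = rng L n'" "n = cmp L h n'" .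
      note h' = layer_subset[OF h] layer_deg[OF h]
      have rh: "rng L h = v" using in'(7) n' h' zero by simp
      show ?thesis
      proof (cases "h \<in> D")
        case True
        have "(h, m, n', w) \<in> Mor arrow_graph"
          using in' n' h' rh True n zero by (auto simp: arrow_in_iff objs_def)
        moreover have "cmp L v m = m" using in' zero by (metis comp_rng)
        ultimately show ?thesis
          using arrow_snd_edge_in[OF True] n' \<open>i = c\<close> rh
          by (intro exI[of _ "(v, v, h, h)"] exI[of _ "(h, m, n', w)"]) (simp add: X vertex zero)
      next
        case False
        have "0 < deg L m $ c"
        proof (rule ccontr)
          assume "\<not> 0 < deg L m $ c"
          \<comment> \<open>then \<open>n\<close> has a single edge of colour \<open>c\<close>, which is in \<open>D\<close>, so it cannot be \<open>h\<close>\<close>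
          then have "count n = 1" "deg L n $ c = 1"
            using pos eq(1)[of c] zero in'(2) count_le[OF in'(3)] count_le[OF in'(4)] eq(2)
            by (auto elim!: objs_cases)
          moreover have "count n = count n'" using n' h' False count_edge[OF h] by simp
          moreover have "deg L n $ c = 1 + deg L n' $ c" using n' h' by simp
          ultimately show False using count_le[OF n'(1)] by simp
        qed
        from first_edge[OF in'(3) this] obtain b m' where
          b: "b \<in> layer L (axis c 1)" and m': "m' \<in> Mor L" "src L b = rng L m'" "m = cmp L b m'" .
        note b' = layer_subset[OF b] layer_deg[OF b]
        have sm: "src L m' = rng L w" using in'(6) m' b' by simp
        have "cmp L b (cmp L m' w) = cmp L h n'" using m' b' sm vw n n' by (simp add: comp_assoc)
        then have bh: "b = h \<and> cmp L m' w = n'"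
          using b' h' m' n' sm vw by (intro factor_unique) auto
        moreover have "cmp L (src L h) n' = n'" using n' by simp
        ultimately have un: "cmp L m' w = cmp L (src L h) n'" by simp
        have "src L n' = src L w" using n' h' in'(8) by simp
        then have "(src L h, m', n', w) \<in> Mor arrow_graph"
          unfolding arrow_in_iff using in'(2) n' m' sm h' bh by (intro conjI un) (simp_all add: objs_def)
        then show ?thesis
          using arrow_old_edge_in[OF h False] n' m' \<open>i = c\<close> rh bh h'
          by (intro exI[of _ "(v, h, h, src L h)"] exI[of _ "(src L h, m', n', w)"]) (simp add: X)
      qed
    next
      case delayed
      have "0 < deg L m $ c"
        using pos eq(1)[of c] delayed in'(2) count_le[OF in'(4)] by (auto elim!: objs_cases)
      from first_edge[OF in'(3) this] obtain b m' where
        b: "b \<in> layer L (axis c 1)" and m': "m' \<in> Mor L" "src L b = rng L m'" "m = cmp L b m'" .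
      note b' = layer_subset[OF b] layer_deg[OF b]
      have sm: "src L m' = rng L w" using in'(6) m' b' by simp
      have "cmp L b (cmp L m' w) = cmp L v n" using m' b' sm vw in'(9) by (simp add: comp_assoc)
      then have bv: "b = v \<and> cmp L m' w = n"
        using b' m' in' sm vw delayed by (intro factor_unique) auto
      have "cmp L (src L v) n = n" "src L v \<in> objs"
        using in'(4,7) vw comp_rng[of n] by (simp_all add: objs_def)
      then have "(src L v, m', n, w) \<in> Mor arrow_graph"
        using in' m' sm vw bv by (simp add: arrow_in_iff)
      then show ?thesis
        using arrow_fst_edge_in[OF delayed(1)] m' \<open>i = c\<close> bv vw \<open>cmp L (src L v) n = n\<close>
        by (intro exI[of _ "(v, v, src L v, src L v)"] exI[of _ "(src L v, m', n, w)"]) (simp add: X)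
    qed
  qed
qed

theorem arrow_k_graph: "k_graph arrow_graph"
  unfolding k_graph_def
proof (intro conjI)
  have "Mor arrow_graph \<subseteq> Mor L \<times> Mor L \<times> Mor L \<times> Mor L"
    using objs_in by (auto simp: arrow_in_iff)
  moreover have "countable (Mor L)" using k_graph by (simp add: k_graph_def)
  ultimately show "countable (Mor arrow_graph)" 
    by (meson countable_SIGMA countable_subset)
  show "factorization_rule arrow_graph"
    by (rule arrow.factorization_rule_if_edges)
      (fact arrow_degree_zero arrow_first_edge arrow_first_edge_unique)+
qed (rule arrow.category arrow.degree_functor)+

theorem arrow_source_free:
  assumes "source_free L"
  shows "source_free arrow_graph"
  unfolding source_free_def is_source_def
proof clarify
  fix v m n w i
  assume V: "(v, m, n, w) \<in> layer arrow_graph 0"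
    and none: "{x \<in> layer arrow_graph (axis i 1). rng arrow_graph x = (v, m, n, w)} = {}"
  from V have in': "(v, m, n, w) \<in> Mor arrow_graph" by (simp add: layer_def)
  have "rng arrow_graph (v, m, n, w) = (v, m, n, w)"
    using V in' by (intro arrow_degree_zero) (simp_all add: layer_def)
  then have noedge: "(v, b, a, u) \<notin> layer arrow_graph (axis i 1)" for b a u
    using none by auto
  have v: "v \<in> objs" using in' by (simp add: arrow_in_iff)
  have ex: "\<exists>x. x \<in> layer L (axis i 1) \<and> rng L x = u" if "u \<in> layer L 0" for u i
    using assms that unfolding source_free_def is_source_def by blast
  show False
  proof (cases "i = c")
    case False
    obtain a where "a \<in> layer L (axis i 1)" "rng L a = src L v"
      using ex[of "src L v" i] objs_in[OF v] by auto
    from arrow_other_edge_in[OF False v this] noedge show False by metis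
  next
    case True
    from v show False
    proof (cases rule: objs_cases)
      case zero
      obtain b where "b \<in> layer L (axis c 1)" "rng L b = v" using ex[OF zero(1)] by blast
      then show False
        using noedge arrow_old_edge_in[of b] arrow_snd_edge_in[of b] True by (cases "b \<in> D") auto
    next
      case delayed
      then show False using noedge arrow_fst_edge_in[of v] True by blast
    qed
  qed
qed

end

section \<open>The delayed graph\<close>

lemma delay_graph_sel [simp]:
  "gverts (delay_graph L f) = OldV ` layer L 0 \<union> Mid ` delayed_edges L f"
  "OldE x \<in> gedges (delay_graph L f) \<longleftrightarrow> x \<in> edges L \<and> x \<notin> delayed_edges L f"
  "Fst g \<in> gedges (delay_graph L f) \<longleftrightarrow> g \<in> delayed_edges L f"
  "Snd g \<in> gedges (delay_graph L f) \<longleftrightarrow> g \<in> delayed_edges L f"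
  "Sq i \<alpha> \<in> gedges (delay_graph L f) \<longleftrightarrow> i \<in> other L f \<and> \<alpha> \<in> delayed_squares L f i"
  "grng (delay_graph L f) = delay_rng L f"
  "gsrc (delay_graph L f) = delay_src L f"
  "gdeg (delay_graph L f) = delay_deg L f"
  by (auto simp: delay_graph_def)

text \<open>Here \<open>c\<close> is the colour of the edge \<open>f\<close>.\<close>

locale delay = higher_rank_graph L for L :: "('a, 'k::finite) kgraph" +
  fixes f :: 'a and c :: 'k
  assumes f_layer: "f \<in> layer L (axis c 1)"
begin

lemma other_iff [simp]: "i \<in> other L f \<longleftrightarrow> i \<noteq> c"
  using layer_deg[OF f_layer] by (simp add: other_def axis_one_inject)

lemma deg_f [simp]: "deg L f = axis c 1"
  by (rule layer_deg[OF f_layer])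

lemma layer_edge: "x \<in> layer L (axis i 1) \<Longrightarrow> x \<in> edges L"
  unfolding edges_iff_layer by blast

lemma edge_Mor: "x \<in> edges L \<Longrightarrow> x \<in> Mor L"
  by (simp add: edges_def)

lemma sk2_paths [simp]:
  "sk2 L x y \<in> paths (skeleton L) \<longleftrightarrow> x \<in> edges L \<and> y \<in> edges L \<and> src L x = rng L y"
  by (auto simp: paths_def path2_def skeleton_def edge_Mor)

lemma bracket_sk2: "y \<in> Mor L \<Longrightarrow> bracket L (sk2 L x y) = cmp L x y"
  by (simp add: bracket_def path2_def skeleton_def)

lemma sim_sk2:
  "sim L (sk2 L x y) (sk2 L x' y') \<longleftrightarrow> x \<in> edges L \<and> y \<in> edges L \<and> x' \<in> edges L \<and> y' \<in> edges L \<and>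
     src L x = rng L y \<and> src L x' = rng L y' \<and> cmp L x y = cmp L x' y'"
  using edge_Mor by (auto simp: sim_def bracket_sk2)

abbreviation "D \<equiv> delayed_edges L f"

lemma delayed_edges_layer: "D \<subseteq> layer L (axis c 1)"
proof -
  have "delay_stage L f m \<subseteq> layer L (axis c 1)" for m
    using f_layer by (cases m) auto
  then show ?thesis by (auto simp: delayed_edges_def)
qed

lemma delayed_edges_opposite:
  assumes "g \<in> D" "e \<in> layer L (axis c 1)" "opposite L f g e"
  shows "e \<in> D"
proof -
  from assms(1) obtain m where "g \<in> delay_stage L f m" unfolding delayed_edges_def by blast
  then have "e \<in> delay_stage L f (Suc m)" using assms(2,3) by auto
  then show ?thesis unfolding delayed_edges_def by blast
qed

end

sublocale delay \<subseteq> parallel_closed L c "delayed_edges L f"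
proof unfold_locales
  show "D \<subseteq> layer L (axis c 1)" by (rule delayed_edges_layer)
next
  fix i h g a b
  assume sq: "i \<noteq> c" "h \<in> layer L (axis c 1)" "g \<in> layer L (axis c 1)" "a \<in> layer L (axis i 1)"
    "b \<in> layer L (axis i 1)" "src L h = rng L a" "src L b = rng L g" "cmp L h a = cmp L b g"
  then have sim: "sim L (sk2 L h a) (sk2 L b g)" "sim L (sk2 L b g) (sk2 L h a)"
    using layer_edge by (auto simp: sim_sk2)
  then have "opposite L f h g" "opposite L f g h"
    unfolding opposite_def using sq(1,4,5) other_iff by blast+
  then show "h \<in> D \<longleftrightarrow> g \<in> D"
    using delayed_edges_opposite sq(2,3) by blast
qed

context delay
begin

text \<open>The identity morphism of the object \<open>v\<close> in \<open>arrow_graph\<close>.\<close>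

definition ident :: "'a \<Rightarrow> 'a \<times> 'a \<times> 'a \<times> 'a" where
  "ident v = (v, rng L v, src L v, v)"

text \<open>The vertices and edges of \<open>arrow_graph\<close> that correspond to those of the delayed graph.
  The edge \<open>Sq i \<alpha>\<close> corresponds to the commuting square with composite \<open>\<alpha>\<close>, whose sides are
  determined by \<open>\<alpha>\<close>.\<close>

primrec vertex_arrow :: "'a dvert \<Rightarrow> 'a \<times> 'a \<times> 'a \<times> 'a" where
  "vertex_arrow (OldV v) = ident v"
| "vertex_arrow (Mid g) = ident g"

primrec edge_arrow :: "('a, 'k) dedge \<Rightarrow> 'a \<times> 'a \<times> 'a \<times> 'a" where
  "edge_arrow (OldE x) = (rng L x, x, x, src L x)"
| "edge_arrow (Fst g) = (g, g, src L g, src L g)"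
| "edge_arrow (Snd g) = (rng L g, rng L g, g, g)"
| "edge_arrow (Sq i \<alpha>) = (THE X. X \<in> layer arrow_graph (axis i 1) \<and>
     (\<exists>h b a g. X = (h, b, a, g) \<and> h \<in> D \<and> cmp L h a = \<alpha>))"

lemma not_layer_zero: "g \<in> D \<Longrightarrow> g \<notin> layer L 0"
  using D_in[of g] vertex(4)[of g] axis_one_nonzero by metis

text \<open>A commuting square \<open>b g = h a\<close> with \<open>g\<close> and \<open>h\<close> delayed, and \<open>a\<close> and \<open>b\<close> of another colour
  \<open>i\<close>.\<close>

definition dsquare :: "'k \<Rightarrow> 'a \<Rightarrow> 'a \<Rightarrow> 'a \<Rightarrow> 'a \<Rightarrow> bool" where
  "dsquare i h b a g \<longleftrightarrow> i \<noteq> c \<and> h \<in> D \<and> g \<in> D \<and> a \<in> layer L (axis i 1) \<and> b \<in> layer L (axis i 1) \<and>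
     src L b = rng L g \<and> src L h = rng L a \<and> cmp L b g = cmp L h a"

lemma dsquare_Mor:
  assumes "dsquare i h b a g"
  shows "h \<in> Mor L" "b \<in> Mor L" "a \<in> Mor L" "g \<in> Mor L" "rng L h = rng L b" "src L a = src L g"
    "deg L h = axis c 1" "deg L g = axis c 1" "deg L a = axis i 1" "deg L b = axis i 1"
proof -
  show in': "h \<in> Mor L" "b \<in> Mor L" "a \<in> Mor L" "g \<in> Mor L"
    using assms D_in by (auto simp: dsquare_def layer_def)
  show "rng L h = rng L b" "src L a = src L g"
    using square_ends[of h a b g] in' assms by (simp_all add: dsquare_def)
  show "deg L h = axis c 1" "deg L g = axis c 1" "deg L a = axis i 1" "deg L b = axis i 1"
    using assms D_in by (auto simp: dsquare_def layer_def)
qed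

lemma dsquare_arrow:
  assumes "dsquare i h b a g"
  shows "(h, b, a, g) \<in> layer arrow_graph (axis i 1)"
proof -
  have "a \<notin> D"
    using assms D_in[of a] dsquare_Mor(9)[OF assms] by (auto simp: dsquare_def axis_one_inject)
  then have "count a = 0" using assms count_edge[of a i] by (simp add: dsquare_def)
  then show ?thesis
    using assms dsquare_Mor[OF assms]
    by (simp add: dsquare_def layer_def[of arrow_graph] arrow_in_iff objs_def vec_eq_iff axis_def)
qed

lemma dsquareI:
  assumes "(h, b, a, g) \<in> layer arrow_graph (axis i 1)" "i \<noteq> c" "h \<in> D"
  shows "dsquare i h b a g"
proof -
  have X: "(h, b, a, g) \<in> Mor arrow_graph" "deg arrow_graph (h, b, a, g) = axis i 1"
    using assms(1) by (simp_all add: layer_def)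
  note edge = arrow_other_edge[OF X assms(2)]
  have "g \<in> objs" using X by (simp add: arrow_in_iff)
  moreover have "deg L g = axis c 1" using edge(3) D_in[OF assms(3)] by simp
  ultimately have "g \<in> D" using vertex(4)[of g] axis_one_nonzero[of c] by (auto simp: objs_def)
  then show ?thesis using X edge assms by (simp add: dsquare_def arrow_in_iff)
qed

lemma dsquare_unique:
  assumes "dsquare i h b a g" "dsquare i h' b' a' g'" "cmp L h a = cmp L h' a'"
  shows "h = h' \<and> b = b' \<and> a = a' \<and> g = g'"
proof -
  note s = assms(1)[unfolded dsquare_def] dsquare_Mor[OF assms(1)]
    and s' = assms(2)[unfolded dsquare_def] dsquare_Mor[OF assms(2)]
  have "h = h' \<and> a = a'"
    by (rule factor_unique) (use s s' assms(3) in simp_all)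
  moreover have "cmp L b g = cmp L b' g'" using s s' assms(3) by metis
  then have "b = b' \<and> g = g'"
    by (intro factor_unique) (use s s' in simp_all)
  ultimately show ?thesis by blast
qed

lemma edge_arrow_Sq:
  assumes "dsquare i h b a g"
  shows "edge_arrow (Sq i (cmp L h a)) = (h, b, a, g)"
  unfolding edge_arrow.simps
proof (rule the_equality)
  show "(h, b, a, g) \<in> layer arrow_graph (axis i 1) \<and>
     (\<exists>h' b' a' g'. (h, b, a, g) = (h', b', a', g') \<and> h' \<in> D \<and> cmp L h' a' = cmp L h a)"
    using dsquare_arrow[OF assms] assms by (auto simp: dsquare_def)
next
  fix X assume "X \<in> layer arrow_graph (axis i 1) \<and>
     (\<exists>h' b' a' g'. X = (h', b', a', g') \<and> h' \<in> D \<and> cmp L h' a' = cmp L h a)"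
  then obtain h' b' a' g' where X: "X = (h', b', a', g')" "(h', b', a', g') \<in> layer arrow_graph (axis i 1)"
    "h' \<in> D" "cmp L h' a' = cmp L h a" by blast
  have "i \<noteq> c" using assms by (simp add: dsquare_def)
  from dsquare_unique[OF dsquareI[OF X(2) this X(3)] assms X(4)] show "X = (h, b, a, g)"
    by (simp add: X(1))
qed

lemma delayed_square_iff:
  "i \<noteq> c \<and> \<alpha> \<in> delayed_squares L f i \<longleftrightarrow> (\<exists>h b a g. dsquare i h b a g \<and> \<alpha> = cmp L h a)"
proof
  assume i: "i \<noteq> c \<and> \<alpha> \<in> delayed_squares L f i"
  then obtain h a where h: "h \<in> D" "a \<in> layer L (axis i 1)" "src L h = rng L a" "\<alpha> = cmp L h a"
    unfolding delayed_squares_def by (auto simp: bracket_sk2 layer_subset)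
  have "h \<in> objs" using h by (simp add: objs_def)
  from arrow_other_edge_in[OF conjunct1[OF i] this h(2) h(3)[symmetric]] obtain b g where
    "(h, b, a, g) \<in> layer arrow_graph (axis i 1)" by metis
  from dsquareI[OF this conjunct1[OF i] h(1)] h(4)
  show "\<exists>h b a g. dsquare i h b a g \<and> \<alpha> = cmp L h a" by blast
next
  assume "\<exists>h b a g. dsquare i h b a g \<and> \<alpha> = cmp L h a"
  then obtain h b a g where s: "dsquare i h b a g" "\<alpha> = cmp L h a" by blast
  have "sk2 L h a \<in> paths (skeleton L)" "bracket L (sk2 L h a) = \<alpha>"
    using s dsquare_Mor[OF s(1)] D_layer layer_edge by (auto simp: dsquare_def bracket_sk2)
  then show "i \<noteq> c \<and> \<alpha> \<in> delayed_squares L f i"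
    using s unfolding delayed_squares_def dsquare_def by blast
qed

lemma sq_left_right:
  assumes "dsquare i h b a g"
  shows "sq_left L f i (cmp L h a) = h" "sq_right L f i (cmp L h a) = g"
proof -
  note s = assms[unfolded dsquare_def] dsquare_Mor[OF assms]
  have edges: "h \<in> layer L (axis c 1)" "g \<in> layer L (axis c 1)" using s D_layer by auto
  show "sq_left L f i (cmp L h a) = h"
    unfolding sq_left_def deg_f
  proof (rule the_equality)
    show "h \<in> layer L (axis c 1) \<and> (\<exists>a'\<in>layer L (axis i 1). sk2 L h a' \<in> paths (skeleton L) \<and>
        bracket L (sk2 L h a') = cmp L h a)"
      using s edges layer_edge by (auto simp: bracket_sk2)
  next
    fix h' assume "h' \<in> layer L (axis c 1) \<and> (\<exists>a'\<in>layer L (axis i 1). sk2 L h' a' \<in> paths (skeleton L) \<and>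
        bracket L (sk2 L h' a') = cmp L h a)"
    then obtain a' where *: "h' \<in> Mor L" "deg L h' = axis c 1" "a' \<in> Mor L" "src L h' = rng L a'"
      "cmp L h' a' = cmp L h a" by (auto simp: bracket_sk2 layer_def)
    have "h' = h \<and> a' = a" by (rule factor_unique) (use s * in simp_all)
    then show "h' = h" by simp
  qed
  show "sq_right L f i (cmp L h a) = g"
    unfolding sq_right_def deg_f
  proof (rule the_equality)
    have "sk2 L b g \<in> paths (skeleton L)" "bracket L (sk2 L b g) = cmp L h a"
      using s edges layer_edge by (auto simp: bracket_sk2)
    then show "g \<in> layer L (axis c 1) \<and> (\<exists>b'\<in>layer L (axis i 1). sk2 L b' g \<in> paths (skeleton L) \<and>
        bracket L (sk2 L b' g) = cmp L h a)"
      using s edges by blast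
  next
    fix g' assume "g' \<in> layer L (axis c 1) \<and> (\<exists>b'\<in>layer L (axis i 1). sk2 L b' g' \<in> paths (skeleton L) \<and>
        bracket L (sk2 L b' g') = cmp L h a)"
    then obtain b' where *: "g' \<in> Mor L" "b' \<in> Mor L" "deg L b' = axis i 1" "src L b' = rng L g'"
      "cmp L b' g' = cmp L h a" by (auto simp: bracket_sk2 layer_def)
    then have "cmp L b' g' = cmp L b g" using s by simp
    then have "b' = b \<and> g' = g" by (intro factor_unique) (use s * in simp_all)
    then show "g' = g" by simp
  qed
qed

lemma delay_edge_cases:
  assumes "x \<in> gedges (delay_graph L f)"
  obtains (OldE) y i where "x = OldE y" "y \<in> layer L (axis i 1)" "y \<notin> D"
  | (Fst) g where "x = Fst g" "g \<in> D"
  | (Snd) g where "x = Snd g" "g \<in> D"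
  | (Sq) i h b a g where "x = Sq i (cmp L h a)" "dsquare i h b a g"
      "delay_rng L f x = Mid h" "delay_src L f x = Mid g" "edge_arrow x = (h, b, a, g)"
proof (cases x)
  case (OldE y)
  then show ?thesis using assms that(1) by (auto simp: edges_iff_layer)
next
  case (Sq i \<alpha>)
  then obtain h b a g where "dsquare i h b a g" "\<alpha> = cmp L h a"
    using assms delayed_square_iff by auto
  then show ?thesis using that(4)[of i h a b g] Sq sq_left_right edge_arrow_Sq by simp
qed (use assms that in auto)

lemma edge_arrow_in:
  assumes "x \<in> gedges (delay_graph L f)"
  shows "edge_arrow x \<in> Mor arrow_graph" "deg arrow_graph (edge_arrow x) = delay_deg L f x"
    "\<exists>i. delay_deg L f x = axis i 1"
    "rng arrow_graph (edge_arrow x) = vertex_arrow (delay_rng L f x)"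
    "src arrow_graph (edge_arrow x) = vertex_arrow (delay_src L f x)"
    "delay_rng L f x \<in> gverts (delay_graph L f)" "delay_src L f x \<in> gverts (delay_graph L f)"
proof -
  from assms have *: "\<exists>i. delay_deg L f x = axis i 1 \<and> edge_arrow x \<in> layer arrow_graph (axis i 1) \<and>
    rng arrow_graph (edge_arrow x) = vertex_arrow (delay_rng L f x) \<and>
    src arrow_graph (edge_arrow x) = vertex_arrow (delay_src L f x) \<and>
    delay_rng L f x \<in> gverts (delay_graph L f) \<and> delay_src L f x \<in> gverts (delay_graph L f)"
  proof (cases rule: delay_edge_cases)
    case (OldE y i)
    then show ?thesis using arrow_old_edge_in[of y i] layer_subset[of y] layer_deg[of y]
      by (intro exI[of _ i]) (auto simp: ident_def)
  next
    case (Fst g)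
    then show ?thesis using arrow_fst_edge_in[of g] D_in[of g]
      by (intro exI[of _ c]) (auto simp: ident_def)
  next
    case (Snd g)
    then show ?thesis using arrow_snd_edge_in[of g] D_in[of g]
      by (intro exI[of _ c]) (auto simp: ident_def)
  next
    case (Sq i h b a g)
    have "h \<in> D" "g \<in> D" using Sq(2) by (simp_all add: dsquare_def)
    moreover have "delay_deg L f x = axis i 1" by (simp add: Sq(1))
    ultimately show ?thesis using dsquare_arrow[OF Sq(2)]
      by (intro exI[of _ i]) (simp add: Sq(3-5) ident_def)
  qed
  then show "edge_arrow x \<in> Mor arrow_graph" "deg arrow_graph (edge_arrow x) = delay_deg L f x"
    "\<exists>i. delay_deg L f x = axis i 1"
    "rng arrow_graph (edge_arrow x) = vertex_arrow (delay_rng L f x)"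
    "src arrow_graph (edge_arrow x) = vertex_arrow (delay_src L f x)"
    "delay_rng L f x \<in> gverts (delay_graph L f)" "delay_src L f x \<in> gverts (delay_graph L f)"
    by (auto simp: layer_def)
qed

lemma rng_src_notin_D: "x \<in> Mor L \<Longrightarrow> rng L x \<notin> D" "x \<in> Mor L \<Longrightarrow> src L x \<notin> D"
  using not_layer_zero rng_layer_zero src_layer_zero by blast+

text \<open>The kind of an edge of the delayed graph can be read off from which of its ends are midpoints
  of delayed edges, and the edge itself from its kind, its colour and the corresponding arrow.\<close>

lemma edge_arrow_recover:
  assumes "x \<in> gedges (delay_graph L f)" "edge_arrow x = (v, b, a, u)" "delay_deg L f x = axis i 1"
  shows "x = (if v \<in> D then if u \<in> D then Sq i (cmp L v a) else Fst v
    else if u \<in> D then Snd u else OldE b)"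
  using assms(1)
proof (cases rule: delay_edge_cases)
  case (OldE y j)
  have "v = rng L y" "b = y" "u = src L y" using assms(2) unfolding OldE(1) by auto
  moreover from this have "v \<notin> D" "u \<notin> D"
    using rng_src_notin_D layer_subset[OF OldE(2)] by simp_all
  ultimately show ?thesis using OldE(1) by simp
next
  case (Fst g)
  have "v = g" "u = src L g" using assms(2) unfolding Fst(1) by auto
  moreover from this have "u \<notin> D" using rng_src_notin_D D_in[OF Fst(2)] by simp
  ultimately show ?thesis using Fst by simp
next
  case (Snd g)
  have "v = rng L g" "u = g" using assms(2) unfolding Snd(1) by auto
  moreover from this have "v \<notin> D" using rng_src_notin_D D_in[OF Snd(2)] by simp
  ultimately show ?thesis using Snd by simp
next
  case (Sq j h b' a' g)
  have "(h, b', a', g) = (v, b, a, u)" using Sq(5) assms(2) by metis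
  moreover have "j = i" using Sq(1) assms(3) by (simp add: axis_one_inject)
  ultimately show ?thesis using Sq(1,2) by (simp add: dsquare_def)
qed

lemma edge_arrow_inject:
  assumes "x \<in> gedges (delay_graph L f)" "y \<in> gedges (delay_graph L f)" "edge_arrow x = edge_arrow y"
  shows "x = y"
proof -
  obtain v b a u where v: "edge_arrow x = (v, b, a, u)" by (metis prod.exhaust)
  obtain i where i: "delay_deg L f x = axis i 1" using edge_arrow_in(3)[OF assms(1)] by blast
  have "delay_deg L f y = axis i 1" "edge_arrow y = (v, b, a, u)"
    using i v edge_arrow_in(2) assms by metis+
  then show ?thesis using edge_arrow_recover[OF assms(1) v i] edge_arrow_recover[OF assms(2)] by metis
qed

lemma edge_arrow_surj:
  assumes "X \<in> layer arrow_graph (axis i 1)"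
  shows "\<exists>x\<in>gedges (delay_graph L f). edge_arrow x = X"
proof -
  obtain v b a u where X: "X = (v, b, a, u)" by (metis prod.exhaust)
  have in': "(v, b, a, u) \<in> Mor arrow_graph" and deg: "deg arrow_graph (v, b, a, u) = axis i 1"
    using assms by (simp_all add: X layer_def)
  show ?thesis
  proof (cases "i = c")
    case True
    show ?thesis
      using in' deg[unfolded True]
    proof (cases rule: arrow_c_edge)
      case old
      then show ?thesis using layer_edge[of b c] by (intro bexI[of _ "OldE b"]) (auto simp: X)
    next
      case fst
      then show ?thesis by (intro bexI[of _ "Fst v"]) (auto simp: X)
    next
      case snd
      then show ?thesis by (intro bexI[of _ "Snd u"]) (auto simp: X)
    qed
  next
    case False
    note edge = arrow_other_edge[OF in' deg False]
    have v: "v \<in> objs" and u: "u \<in> objs" using in' by (simp_all add: arrow_in_iff)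
    from v show ?thesis
    proof (cases rule: objs_cases)
      case zero
      then have "deg L u = 0" using edge(3) by simp
      then have u': "u = rng L u" using degree_zero_identity(1) objs_in[OF u] by metis
      note in'' = in'[unfolded arrow_in_iff]
      have "u = src L b" using in'' u' by metis
      moreover have "v = rng L b" using in'' zero by metis
      moreover have "cmp L b u = b" "cmp L v a = a"
        using in'' zero calculation comp_src comp_rng by metis+
      moreover have "b \<notin> D" using edge(1) False D_in[of b] by (auto simp: layer_def axis_one_inject)
      ultimately show ?thesis
        using in'' layer_edge[OF edge(1)] by (intro bexI[of _ "OldE b"]) (auto simp: X)
    next
      case delayed
      have "dsquare i v b a u" using dsquareI assms False delayed(1) by (simp add: X)
      then show ?thesis
        using edge_arrow_Sq delayed_square_iff
        by (intro bexI[of _ "Sq i (cmp L v a)"]) (auto simp: X simp del: edge_arrow.simps)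
    qed
  qed
qed

lemma arrow_layer_zero: "layer arrow_graph 0 = ident ` objs"
proof (intro equalityI subsetI)
  fix X assume X: "X \<in> layer arrow_graph 0"
  obtain v m n w where X': "X = (v, m, n, w)" by (metis prod.exhaust)
  have "rng arrow_graph X = X" using X by (intro arrow_degree_zero) (simp_all add: layer_def)
  moreover have "v \<in> objs" using X unfolding X' by (simp add: layer_def arrow_in_iff)
  moreover have "rng arrow_graph X = ident v" by (simp add: X' ident_def)
  ultimately show "X \<in> ident ` objs" by (metis imageI)
next
  fix X assume "X \<in> ident ` objs"
  then obtain v where v: "v \<in> objs" "X = (v, rng L v, src L v, v)" unfolding ident_def by blast
  note v' = objs_in[OF v(1)]
  have "axis c (0 :: nat) = 0" by (simp add: axis_eq_0_iff)
  then have "deg arrow_graph X = 0" using v' by (simp add: v(2) count_vertex)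
  moreover have "X \<in> Mor arrow_graph" using v v' by (simp add: arrow_in_iff)
  ultimately show "X \<in> layer arrow_graph 0" by (simp add: layer_def)
qed

end

sublocale delay \<subseteq> labelled: skeleton_labelling arrow_graph "delay_graph L f" vertex_arrow edge_arrow
proof unfold_locales
  show "k_graph arrow_graph" by (rule arrow_k_graph)
  show "bij_betw vertex_arrow (gverts (delay_graph L f)) (layer arrow_graph 0)"
    using not_layer_zero
    by (auto simp: bij_betw_def inj_on_def arrow_layer_zero objs_def image_Un image_image ident_def)
  show "bij_betw edge_arrow (gedges (delay_graph L f)) (edges arrow_graph)"
    unfolding bij_betw_def
  proof (intro conjI equalityI subsetI)
    show "inj_on edge_arrow (gedges (delay_graph L f))"
      by (rule inj_onI) (rule edge_arrow_inject)
    fix X assume "X \<in> edges arrow_graph"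
    then show "X \<in> edge_arrow ` gedges (delay_graph L f)"
      using edge_arrow_surj unfolding edges_iff_layer by blast
  next
    fix X assume "X \<in> edge_arrow ` gedges (delay_graph L f)"
    then obtain x where x: "x \<in> gedges (delay_graph L f)" "X = edge_arrow x" by blast
    then show "X \<in> edges arrow_graph"
      using edge_arrow_in(1-3)[OF x(1)] unfolding edges_iff_layer by (auto simp: layer_def)
  qed
next
  fix x assume "x \<in> gedges (delay_graph L f)"
  note edge_arrow_in[OF this]
  then show "grng (delay_graph L f) x \<in> gverts (delay_graph L f) \<and>
      vertex_arrow (grng (delay_graph L f) x) = rng arrow_graph (edge_arrow x)"
    "gsrc (delay_graph L f) x \<in> gverts (delay_graph L f) \<and>
      vertex_arrow (gsrc (delay_graph L f) x) = src arrow_graph (edge_arrow x)"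
    "gdeg (delay_graph L f) x = deg arrow_graph (edge_arrow x)"
    by (simp_all only: delay_graph_sel(6-8))
qed

context delay
begin

text \<open>In the case \<open>cube\<close>, the face \<open>\<gamma>\<close> is given by its sides \<open>b'\<close> and \<open>l'\<close> only; its other two sides
  are \<open>l\<close> and the edge \<open>a'\<close> for which \<open>d a = a' d'\<close>.\<close>

lemma delay_gen_sound:
  assumes "delay_gen L f p q" "p \<in> paths (delay_graph L f)" "q \<in> paths (delay_graph L f)"
  shows "labelled.composite p = labelled.composite q"
proof -
  have path2_composite: "labelled.composite (dl2 L f x y) = cmp arrow_graph (edge_arrow x) (edge_arrow y)"
    if "dl2 L f x y \<in> paths (delay_graph L f)" for x y
    using that by (intro labelled.path2_in) (auto simp: labelled.paths_iff path2_def)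
  from assms show ?thesis
  proof (induction rule: delay_gen.induct)
    case (old x y x' y')
    then show ?case
      using square_ends[of x y x' y'] edge_Mor by (simp add: path2_composite sim_sk2)
  next
    case (square_upper i g h a b \<alpha>)
    then have s: "dsquare i h b a g" "\<alpha> = cmp L h a"
      by (auto simp: dsquare_def sim_sk2 bracket_sk2 edge_Mor)
    note s' = dsquare_Mor[OF s(1)] s(1)[unfolded dsquare_def]
    show ?case
      unfolding path2_composite[OF square_upper(8)] path2_composite[OF square_upper(9)]
      unfolding s(2) edge_arrow_Sq[OF s(1)] using s' by (simp add: comp_rng_eq comp_src_eq)
  next
    case (square_lower i g h a b \<alpha>)
    then have s: "dsquare i h b a g" "\<alpha> = cmp L h a"
      by (auto simp: dsquare_def sim_sk2 bracket_sk2 edge_Mor)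
    note s' = dsquare_Mor[OF s(1)] s(1)[unfolded dsquare_def]
    show ?case
      unfolding path2_composite[OF square_lower(8)] path2_composite[OF square_lower(9)]
      unfolding s(2) edge_arrow_Sq[OF s(1)] using s' by (simp add: comp_rng_eq comp_src_eq)
  next
    case (cube i j g h l l' a b b' e d e' d' \<alpha> \<beta> \<delta> \<gamma>)
    note layers = cube.hyps(7-14)
    note Mors = layers[THEN layer_subset] and degs = layers[THEN layer_deg]
    note DM = D_in[OF cube.hyps(4)] D_in[OF cube.hyps(5)] D_in[OF cube.hyps(6)]
    from cube.hyps have sims: "src L g = rng L a" "src L b = rng L h" "cmp L g a = cmp L b h"
      "src L e = rng L g" "src L l = rng L d" "cmp L e g = cmp L l d"
      "src L e = rng L b" "src L b' = rng L e'" "cmp L e b = cmp L b' e'"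
      "src L e' = rng L h" "src L l' = rng L d'" "cmp L e' h = cmp L l' d'"
      by (simp_all add: sim_sk2)
    have sA: "dsquare i g b a h" and sB: "dsquare j l e d g"
      using cube.hyps sims by (auto simp: dsquare_def)
    have "l' \<in> D"
      using parallel[of j l' h d' e'] cube.hyps sims D_layer by auto
    then have sD: "dsquare j l' e' d' h"
      using cube.hyps sims by (auto simp: dsquare_def)
    note mA = dsquare_Mor[OF sA] and mB = dsquare_Mor[OF sB] and mD = dsquare_Mor[OF sD]
    have b'l': "src L b' = rng L l'" using sims mD by simp
    have da: "src L d = rng L a" using sims mB by simp
    have "deg L (cmp L d a) = axis i 1 + axis j 1" "cmp L d a \<in> Mor L"
      using da mA mB by (simp_all add: add.commute)
    from factor[OF this(2,1)] obtain a' d'' where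
      a': "a' \<in> layer L (axis i 1)" and d'': "d'' \<in> layer L (axis j 1)"
      and ad: "src L a' = rng L d''" "cmp L d a = cmp L a' d''" by metis
    note a'd'' = layer_subset[OF a'] layer_deg[OF a'] layer_subset[OF d''] layer_deg[OF d'']
    have la': "src L l = rng L a'"
      using ad da mA mB a'd'' sims(5) rng_comp[of d a] rng_comp[of a' d''] by metis
    have "cmp L (cmp L l a') d'' = cmp L l (cmp L d a)"
      using a'd'' mB la' ad by (simp add: comp_assoc)
    also have "\<dots> = cmp L (cmp L e g) a"
      unfolding sims(6) by (rule comp_assoc[symmetric]) (use mA mB da sims in simp_all)
    also have "\<dots> = cmp L e (cmp L b h)"
      unfolding sims(3)[symmetric] by (rule comp_assoc) (use mA mB sims in simp_all)
    also have "\<dots> = cmp L (cmp L b' e') h"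
      unfolding sims(9)[symmetric] by (rule comp_assoc[symmetric]) (use mA mB sims in simp_all)
    also have "\<dots> = cmp L b' (cmp L l' d')"
      unfolding sims(12)[symmetric] by (rule comp_assoc) (use mA mD Mors sims in simp_all)
    also have "\<dots> = cmp L (cmp L b' l') d'"
      by (rule comp_assoc[symmetric]) (use mD Mors sims b'l' in simp_all)
    finally have "cmp L l a' = cmp L b' l' \<and> d'' = d'"
      using a'd'' la' ad Mors degs b'l' sims mB mD
      by (intro factor_unique) (simp_all add: add.commute)
    then have sC: "dsquare i l b' a' l'" and d': "d'' = d'"
      using cube.hyps \<open>l' \<in> D\<close> a' la' b'l' by (auto simp: dsquare_def)
    have names: "\<alpha> = cmp L g a" "\<beta> = cmp L l d" "\<delta> = cmp L l' d'" "\<gamma> = cmp L l a'"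
      using cube.hyps mA mB mD sims \<open>_ \<and> d'' = d'\<close> by (simp_all add: bracket_sk2)
    show ?case
      unfolding path2_composite[OF cube.prems(1)] path2_composite[OF cube.prems(2)]
      unfolding names edge_arrow_Sq[OF sA] edge_arrow_Sq[OF sB] edge_arrow_Sq[OF sC] edge_arrow_Sq[OF sD]
      using sims ad d' by simp
  qed
qed

lemma delay_deg_eq_c:
  assumes "x \<in> gedges (delay_graph L f)" "delay_deg L f x = axis c 1"
  obtains (OldE) y where "x = OldE y" "y \<in> layer L (axis c 1)" "y \<notin> D"
  | (Fst) g where "x = Fst g" "g \<in> D"
  | (Snd) g where "x = Snd g" "g \<in> D"
  using assms(1)
proof (cases rule: delay_edge_cases)
  case (OldE y i)
  then show ?thesis using that(1) assms(2) layer_deg[OF OldE(2)] by simp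
next
  case (Sq i h b a g)
  then show ?thesis using assms(2) by (simp add: dsquare_def axis_one_inject)
qed (use that in blast)+

lemma delay_deg_neq_c:
  assumes "x \<in> gedges (delay_graph L f)" "delay_deg L f x = axis i 1" "i \<noteq> c"
  obtains (OldE) y where "x = OldE y" "y \<in> layer L (axis i 1)" "y \<notin> D"
  | (Sq) h b a g where "x = Sq i (cmp L h a)" "dsquare i h b a g"
      "delay_rng L f x = Mid h" "delay_src L f x = Mid g" "edge_arrow x = (h, b, a, g)"
  using assms(1)
proof (cases rule: delay_edge_cases)
  case (OldE y j)
  then show ?thesis using that(1) assms(2) layer_deg[OF OldE(2)] by simp
next
  case (Sq j h b a g)
  moreover have "j = i" using Sq(1) assms(2) by (simp add: axis_one_inject)
  ultimately show ?thesis using that(2) by blast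
qed (use assms in \<open>simp_all add: axis_one_inject\<close>)

lemma path_cong_delay_gen:
  assumes "delay_gen L f (dl2 L f x y) (dl2 L f x' y')"
    "{x, y, x', y'} \<subseteq> gedges (delay_graph L f)" "delay_src L f x = delay_rng L f y"
    "delay_src L f x' = delay_rng L f y'"
  shows "path_cong (delay_graph L f) (delay_gen L f) (dl2 L f x y) (dl2 L f x' y')"
  using assms by (intro path_cong.base labelled.path2_in) simp_all

lemma old_square:
  assumes "{OldE x, OldE y, OldE x', OldE y'} \<subseteq> gedges (delay_graph L f)" "src L x = rng L y"
    "src L x' = rng L y'" "deg L x \<noteq> deg L y" "deg L x' \<noteq> deg L y'"
    "cmp arrow_graph (edge_arrow (OldE x)) (edge_arrow (OldE y)) =
      cmp arrow_graph (edge_arrow (OldE x')) (edge_arrow (OldE y'))"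
  shows "path_cong (delay_graph L f) (delay_gen L f)
    (dl2 L f (OldE x) (OldE y)) (dl2 L f (OldE x') (OldE y'))"
  using assms by (intro path_cong_delay_gen delay_gen.old) (auto simp: sim_sk2)

text \<open>The commuting squares with two sides of the colour of \<open>f\<close>: if \<open>x\<close> is an old edge, all sides
  are old; if it is the first or second half of a delayed edge, the square is the lower or upper
  half of a delayed square.\<close>

lemma square_c:
  assumes in': "{x, y, x', y'} \<subseteq> gedges (delay_graph L f)"
    and ends: "delay_src L f x = delay_rng L f y" "delay_src L f y' = delay_rng L f x'"
      "delay_rng L f x = delay_rng L f y'" "delay_src L f y = delay_src L f x'"
    and deg: "delay_deg L f x = axis c 1" "delay_deg L f x' = axis c 1"
      "delay_deg L f y = axis i 1" "delay_deg L f y' = axis i 1" "i \<noteq> c"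
    and eq: "cmp arrow_graph (edge_arrow x) (edge_arrow y) = cmp arrow_graph (edge_arrow y') (edge_arrow x')"
  shows "path_cong (delay_graph L f) (delay_gen L f) (dl2 L f x y) (dl2 L f y' x')"
proof -
  from in' have x: "x \<in> gedges (delay_graph L f)" and y: "y \<in> gedges (delay_graph L f)"
    and x': "x' \<in> gedges (delay_graph L f)" and y': "y' \<in> gedges (delay_graph L f)" by auto
  from x deg(1) show ?thesis
  proof (cases rule: delay_deg_eq_c)
    case X: (OldE x1)
    from y deg(3,5) obtain y1 where Y: "y = OldE y1" "y1 \<in> layer L (axis i 1)"
      by (cases rule: delay_deg_neq_c) (use ends(1) X(1) in simp_all)
    from y' deg(4,5) obtain y1' where Y': "y' = OldE y1'" "y1' \<in> layer L (axis i 1)"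
      by (cases rule: delay_deg_neq_c) (use ends(3) X(1) in simp_all)
    from x' deg(2) obtain x1' where X': "x' = OldE x1'" "x1' \<in> layer L (axis c 1)"
      by (cases rule: delay_deg_eq_c) (use ends(2,4) Y(1) Y'(1) in simp_all)
    show ?thesis
      unfolding X(1) Y(1) X'(1) Y'(1)
    proof (rule old_square)
      show "deg L x1 \<noteq> deg L y1" "deg L y1' \<noteq> deg L x1'"
        using deg X(1) Y(1) X'(1) Y'(1) by (simp_all add: axis_one_inject)
    qed (use in' ends eq in \<open>simp_all only: X(1) Y(1) X'(1) Y'(1) delay_src.simps delay_rng.simps
          dvert.inject insert_commute\<close>)
  next
    case X: (Fst h)
    from y deg(3,5) obtain a where Y: "y = OldE a" "a \<in> layer L (axis i 1)"
      by (cases rule: delay_deg_neq_c) (use ends(1) X(1) in simp_all)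
    from y' deg(4,5) obtain h' b a' g where Y': "y' = Sq i (cmp L h' a')" "dsquare i h' b a' g"
      "delay_rng L f y' = Mid h'" "delay_src L f y' = Mid g" "edge_arrow y' = (h', b, a', g)"
      by (cases rule: delay_deg_neq_c) (use ends(3) X(1) in simp_all)
    from x' deg(2) have X': "x' = Fst g"
      by (cases rule: delay_deg_eq_c) (use ends(2) Y'(4) in simp_all)
    have h: "h' = h" using ends(3) X(1) Y'(3) by simp
    note s = Y'(2)[unfolded dsquare_def] dsquare_Mor[OF Y'(2)]
    have "cmp L h a = cmp L b g" using eq Y'(5) by (simp add: X(1) Y(1) X' h)
    moreover have sa: "src L h = rng L a" using ends(1) by (simp add: X(1) Y(1))
    ultimately have sim: "sim L (sk2 L b g) (sk2 L h a)"
      using s Y(2) X(2) D_layer layer_edge by (auto simp: sim_sk2)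
    have "delay_gen L f (dl2 L f (Sq i (cmp L h' a')) (Fst g)) (dl2 L f (Fst h) (OldE a))"
      using s X(2) Y(2) sim by (intro delay_gen.square_lower[of i L f g h a b]) (auto simp: bracket_sk2)
    then have "path_cong (delay_graph L f) (delay_gen L f) (dl2 L f y' x') (dl2 L f x y)"
      unfolding X(1) Y(1) X' Y'(1)
      by (rule path_cong_delay_gen)
        (use in' ends X' X(1) Y(1) Y'(1) in \<open>simp_all only: insert_commute\<close>)
    then show ?thesis by (rule path_cong.sym)
  next
    case X: (Snd h)
    from y deg(3,5) obtain h' b a g where Y: "y = Sq i (cmp L h' a)" "dsquare i h' b a g"
      "delay_rng L f y = Mid h'" "delay_src L f y = Mid g" "edge_arrow y = (h', b, a, g)"
      by (cases rule: delay_deg_neq_c) (use ends(1) X(1) in simp_all)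
    from y' deg(4,5) obtain b' where Y': "y' = OldE b'" "b' \<in> layer L (axis i 1)"
      by (cases rule: delay_deg_neq_c) (use ends(3) X(1) in simp_all)
    from x' deg(2) have X': "x' = Snd g"
      by (cases rule: delay_deg_eq_c) (use ends(4) Y(4) in simp_all)
    have h: "h' = h" using ends(1) X(1) Y(3) by simp
    note s = Y(2)[unfolded dsquare_def] dsquare_Mor[OF Y(2)]
    have sb: "src L b' = rng L g" using ends(2) by (simp add: Y'(1) X')
    have ha: "cmp L h a = cmp L b' g" using eq Y(5) by (simp add: X(1) Y'(1) X' h)
    then have sim: "sim L (sk2 L b' g) (sk2 L h a)"
      using s h sb Y'(2) X(2) D_layer layer_edge by (auto simp: sim_sk2)
    have "delay_gen L f (dl2 L f (OldE b') (Snd g)) (dl2 L f (Snd h) (Sq i (cmp L h' a)))"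
      using s h X(2) Y'(2) sim ha by (intro delay_gen.square_upper[of i L f g h a b']) (auto simp: bracket_sk2)
    then have "path_cong (delay_graph L f) (delay_gen L f) (dl2 L f y' x') (dl2 L f x y)"
      unfolding X(1) Y(1) X' Y'(1)
      by (rule path_cong_delay_gen)
        (use in' ends X' X(1) Y(1) Y'(1) in \<open>simp_all only: insert_commute\<close>)
    then show ?thesis by (rule path_cong.sym)
  qed
qed

text \<open>The commuting squares without sides of the colour of \<open>f\<close>: all sides are old, or the square
  joins the midpoints of the parallel edges \<open>g\<close>, \<open>h\<close>, \<open>l\<close>, \<open>l'\<close> of a 3-cube.\<close>

lemma square_other:
  assumes in': "{x, y, x', y'} \<subseteq> gedges (delay_graph L f)"
    and ends: "delay_src L f x = delay_rng L f y" "delay_src L f y' = delay_rng L f x'"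
      "delay_rng L f x = delay_rng L f y'" "delay_src L f y = delay_src L f x'"
    and deg: "delay_deg L f x = axis j 1" "delay_deg L f x' = axis j 1"
      "delay_deg L f y = axis i 1" "delay_deg L f y' = axis i 1" "i \<noteq> c" "j \<noteq> c" "i \<noteq> j"
    and eq: "cmp arrow_graph (edge_arrow x) (edge_arrow y) = cmp arrow_graph (edge_arrow y') (edge_arrow x')"
  shows "path_cong (delay_graph L f) (delay_gen L f) (dl2 L f x y) (dl2 L f y' x')"
proof -
  from in' have x: "x \<in> gedges (delay_graph L f)" and y: "y \<in> gedges (delay_graph L f)"
    and x': "x' \<in> gedges (delay_graph L f)" and y': "y' \<in> gedges (delay_graph L f)" by auto
  from x deg(1,6) show ?thesis
  proof (cases rule: delay_deg_neq_c)
    case X: (OldE x1)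
    from y deg(3,5) obtain y1 where Y: "y = OldE y1" "y1 \<in> layer L (axis i 1)"
      by (cases rule: delay_deg_neq_c) (use ends(1) X(1) in simp_all)
    from y' deg(4,5) obtain y1' where Y': "y' = OldE y1'" "y1' \<in> layer L (axis i 1)"
      by (cases rule: delay_deg_neq_c) (use ends(3) X(1) in simp_all)
    from x' deg(2,6) obtain x1' where X': "x' = OldE x1'" "x1' \<in> layer L (axis j 1)"
      by (cases rule: delay_deg_neq_c) (use ends(2) Y'(1) in simp_all)
    show ?thesis
      unfolding X(1) Y(1) X'(1) Y'(1)
    proof (rule old_square)
      show "deg L x1 \<noteq> deg L y1" "deg L y1' \<noteq> deg L x1'"
        using deg X(1) Y(1) X'(1) Y'(1) by (simp_all add: axis_one_inject)
    qed (use in' ends eq in \<open>simp_all only: X(1) Y(1) X'(1) Y'(1) delay_src.simps delay_rng.simps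
          dvert.inject insert_commute\<close>)
  next
    case X: (Sq l e d g)
    from y deg(3,5) obtain g' b a h where Y: "y = Sq i (cmp L g' a)" "dsquare i g' b a h"
      "delay_rng L f y = Mid g'" "delay_src L f y = Mid h" "edge_arrow y = (g', b, a, h)"
      by (cases rule: delay_deg_neq_c) (use ends(1) X(4) in simp_all)
    from y' deg(4,5) obtain l1 b' a' l' where Y': "y' = Sq i (cmp L l1 a')" "dsquare i l1 b' a' l'"
      "delay_rng L f y' = Mid l1" "delay_src L f y' = Mid l'" "edge_arrow y' = (l1, b', a', l')"
      by (cases rule: delay_deg_neq_c) (use ends(3) X(3) in simp_all)
    from x' deg(2,6) obtain l2 e' d' h1 where X': "x' = Sq j (cmp L l2 d')" "dsquare j l2 e' d' h1"
      "delay_rng L f x' = Mid l2" "delay_src L f x' = Mid h1" "edge_arrow x' = (l2, e', d', h1)"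
      by (cases rule: delay_deg_neq_c) (use ends(2) Y'(4) in simp_all)
    have "Mid g' = Mid g" using ends(1) X(4) Y(3) by metis
    then have g: "g' = g" by simp
    have "Mid l1 = Mid l" using ends(3) X(3) Y'(3) by metis
    then have l: "l1 = l" by simp
    have "Mid l2 = Mid l'" using ends(2) X'(3) Y'(4) by metis
    then have l': "l2 = l'" by simp
    have "Mid h1 = Mid h" using ends(4) X'(4) Y(4) by metis
    then have h: "h1 = h" by simp
    have eb: "cmp L e b = cmp L b' e'" using eq by (simp only: X(5) Y(5) X'(5) Y'(5) arrow_sel prod.inject)
    note sB = X(2) and sA = Y(2)[unfolded g] and sC = Y'(2)[unfolded l] and sD = X'(2)[unfolded l' h]
    note A = sA[unfolded dsquare_def] dsquare_Mor[OF sA] and B = sB[unfolded dsquare_def] dsquare_Mor[OF sB]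
      and C = sC[unfolded dsquare_def] dsquare_Mor[OF sC] and E = sD[unfolded dsquare_def] dsquare_Mor[OF sD]
    have lay: "g \<in> layer L (axis c 1)" "h \<in> layer L (axis c 1)" "l \<in> layer L (axis c 1)" "l' \<in> layer L (axis c 1)"
      using A B C E D_layer by auto
    have sims: "sim L (sk2 L g a) (sk2 L b h)" "sim L (sk2 L e g) (sk2 L l d)"
      "sim L (sk2 L e' h) (sk2 L l' d')"
      using A B E lay layer_edge by (auto simp: sim_sk2)
    have "src L e = rng L b" "src L b' = rng L e'" using A B C E by simp_all
    then have sim: "sim L (sk2 L e b) (sk2 L b' e')"
      using A B C E eb layer_edge by (auto simp: sim_sk2)
    have "delay_gen L f (dl2 L f (Sq j (cmp L e g)) (Sq i (cmp L g a)))
      (dl2 L f (Sq i (cmp L b' l')) (Sq j (cmp L e' h)))"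
      using A B C E lay deg(5-7) sims sim
      by (intro delay_gen.cube[of i L f j g h l l' a b b' e d e' d']) (simp_all add: bracket_sk2)
    moreover have "cmp L e g = cmp L l d" "cmp L b' l' = cmp L l a'" "cmp L e' h = cmp L l' d'"
      using B C E by simp_all
    ultimately have "delay_gen L f (dl2 L f x y) (dl2 L f y' x')"
      by (simp only: X(1) Y(1) X'(1) Y'(1) g l l')
    then show ?thesis using in' ends by (intro path_cong_delay_gen) auto
  qed
qed

end

sublocale delay \<subseteq> presented: presentation arrow_graph "delay_graph L f" vertex_arrow edge_arrow "delay_gen L f"
proof unfold_locales
  fix p q assume "p \<in> paths (delay_graph L f)" "q \<in> paths (delay_graph L f)" "delay_gen L f p q"
  then show "labelled.composite p = labelled.composite q" by (intro delay_gen_sound)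
next
  let ?G = "delay_graph L f"
  fix x y x' y'
  assume in': "{x, y, x', y'} \<subseteq> gedges ?G" and ends: "gsrc ?G x = grng ?G y" "gsrc ?G y' = grng ?G x'"
    and deg: "gdeg ?G x = gdeg ?G x'" "gdeg ?G y = gdeg ?G y'" "gdeg ?G x \<noteq> gdeg ?G y"
    and eq: "cmp arrow_graph (edge_arrow x) (edge_arrow y) = cmp arrow_graph (edge_arrow y') (edge_arrow x')"
  have p: "dl2 L f x y \<in> paths ?G" "dl2 L f y' x' \<in> paths ?G"
    "labelled.composite (dl2 L f x y) = labelled.composite (dl2 L f y' x')"
    using in' ends eq labelled.path2_in[of x y] labelled.path2_in[of y' x'] by auto
  have ends': "delay_rng L f x = delay_rng L f y'" "delay_src L f y = delay_src L f x'"
    using labelled.same_composite_ends[OF p] by (simp_all add: path2_def psrc_def)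
  have "x \<in> gedges ?G" "y \<in> gedges ?G" using in' by auto
  then obtain j i where ji: "delay_deg L f x = axis j 1" "delay_deg L f y = axis i 1"
    using edge_arrow_in(3) by metis
  have ij: "i \<noteq> j" using deg(3) ji by auto
  consider "j = c" | "i = c" | "i \<noteq> c" "j \<noteq> c" by blast
  then show "path_cong ?G (delay_gen L f) (dl2 L f x y) (dl2 L f y' x')"
  proof cases
    case 1
    then show ?thesis using in' ends ends' deg ji ij eq
      by (intro square_c[of x y x' y' i]) auto
  next
    case 2
    then have "path_cong ?G (delay_gen L f) (dl2 L f y' x') (dl2 L f x y)"
      using in' ends ends' deg ji ij eq
      by (intro square_c[of y' x' y x j]) auto
    then show ?thesis by (rule path_cong.sym)
  next
    case 3
    then show ?thesis using in' ends ends' deg ji ij eq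
      by (intro square_other[of x y x' y' j i]) auto
  qed
qed

theorem theorem4p2:
  fixes L :: "('a, 'k::finite) kgraph" and f :: 'a
  assumes "k_graph L" and "row_finite L" and "source_free L" and "f \<in> edges L"
  shows "k_graph (delayed L f) \<and> source_free (delayed L f)"
proof -
  obtain c where c: "f \<in> layer L (axis c 1)" using assms(4) unfolding edges_iff_layer by blast
  interpret delay L f c by unfold_locales (fact assms(1) c)+
  interpret iso: kgraph_iso arrow_graph "delayed L f" presented.fibre
    unfolding delayed_def by (rule presented.quotient_iso)
  show ?thesis
    using iso.k_graph_iso iso.source_free_iso arrow_source_free assms(3) by blast
qed

end
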